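(* Let $p$ be an odd prime and $n\ge 2$. Then $$B_{D_n}\big(\mathbb F_p(n-1,1)\big)=\{d_{n-1,0}^{m_0}\cdots d_{n-1,n-2}^{m_{n-2}} : 0\le m_i\le p-1\}\ \cup\ \bigcup_{t=1}^{n-1}\{d_{n-1,t-1}^{\,p}\,d_{n-1,t}^{m_t}\cdots d_{n-1,n-2}^{m_{n-2}} : 0\le m_i\le p-1\}$$ is a free module basis of $\mathbb F_p(n-1,1)=\mathbb F_p[y_1,\dots,y_n]^{P(n-1,1)}$ over $D_n=\mathbb F_p[y_1,\dots,y_n]^{GL(n,\mathbb F_p)}$.
   Context: $GL(n,\mathbb F_p)$ acts on $\mathbb F_p[y_1,\dots,y_n]$ by algebra automorphisms determined by $(a_{ij})\,y_k=\sum_i a_{ik}y_i$. The parabolic subgroup is $P(k,n-k)=\left\{\begin{pmatrix}A&C\\0&B\end{pmatrix}: A\in GL(k,\mathbb F_p),\ B\in GL(n-k,\mathbb F_p)\right\}$. For $m\ge1$ and $0\le i\le m$ let $L_{m,i}$ be the determinant of the $m\times m$ matrix obtained from the matrix with rows $(y_1^{p^j},\dots,y_m^{p^j})$, $0\le j\le m$, by deleting the row $j=i$; put $L_m=L_{m,m}$ and $d_{m,i}=L_{m,i}/L_m\in\mathbb F_p[y_1,\dots,y_m]$ (the Dickson invariants). Then $D_n=\mathbb F_p[d_{n,0},\dots,d_{n,n-1}]$. For an algebra $A'$ over $A$, $B_A(A')$ denotes a free module basis of $A'$ over $A$. *)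

theory Defs
  imports
    "HOL-Library.Poly_Mapping"
    "Jordan_Normal_Form.Determinant"
    "Berlekamp_Zassenhaus.Finite_Field"
begin

text \<open>
  The prime is \<open>p = CARD('p)\<close> for a type \<open>'p\<close> of class \<open>prime_card\<close>, and \<open>'p mod_ring\<close> is the
  field of integers modulo \<open>p\<close>. A monomial is an exponent function \<open>nat \<Rightarrow>\<^sub>0 nat\<close>.
  Matrix indices start at 0, so \<open>var k\<close> is the variable \<open>y\<^bsub>k+1\<^esub>\<close>, and the polynomial ring in
  \<open>y\<^sub>1, \<dots>, y\<^sub>n\<close> is the subring \<open>poly_ring n\<close> of the ring of polynomials in countably many
  variables. This makes \<open>poly_ring (n - 1)\<close> a subset of \<open>poly_ring n\<close>.
\<close>

type_synonym 'p mpol = "(nat \<Rightarrow>\<^sub>0 nat) \<Rightarrow>\<^sub>0 'p mod_ring"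

definition const :: "'p::prime_card mod_ring \<Rightarrow> 'p mpol" where
  "const c = Poly_Mapping.single 0 c"

definition var :: "nat \<Rightarrow> 'p::prime_card mpol" where
  "var k = Poly_Mapping.single (Poly_Mapping.single k 1) 1"

definition poly_ring :: "nat \<Rightarrow> 'p::prime_card mpol set" where
  "poly_ring n = {f. \<forall>m \<in> Poly_Mapping.keys f. Poly_Mapping.keys m \<subseteq> {..<n}}"

definition substitute :: "(nat \<Rightarrow> 'p::prime_card mpol) \<Rightarrow> 'p mpol \<Rightarrow> 'p mpol" where
  "substitute g f = (\<Sum>m\<in>Poly_Mapping.keys f.
     const (Poly_Mapping.lookup f m) * (\<Prod>k\<in>Poly_Mapping.keys m. g k ^ Poly_Mapping.lookup m k))"

text \<open>
  Column \<open>k\<close> of the matrix gives the image of \<open>y\<^sub>k\<close>. For an \<open>n \<times> n\<close> matrix, \<open>act\<close> is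
  meaningful only on \<open>poly_ring n\<close>.
\<close>

definition act :: "'p::prime_card mod_ring mat \<Rightarrow> 'p mpol \<Rightarrow> 'p mpol" where
  "act A = substitute (\<lambda>k. \<Sum>i<dim_row A. const (A $$ (i, k)) * var i)"

definition invariants :: "nat \<Rightarrow> 'p::prime_card mod_ring mat set \<Rightarrow> 'p mpol set" where
  "invariants n G = {f \<in> poly_ring n. \<forall>A\<in>G. act A f = f}"

definition GL :: "nat \<Rightarrow> 'p::prime_card mod_ring mat set" where
  "GL n = {A \<in> carrier_mat n n. invertible_mat A}"

definition parabolic :: "nat \<Rightarrow> nat \<Rightarrow> 'p::prime_card mod_ring mat set" where
  "parabolic k l = {four_block_mat A C (0\<^sub>m l k) B | A B C.
     A \<in> GL k \<and> B \<in> GL l \<and> C \<in> carrier_mat k l}"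

text \<open>
  Row \<open>r\<close> of the matrix for \<open>L m i\<close> carries the exponent \<open>p ^ j\<close>, where \<open>j\<close> is the \<open>r\<close>-th
  element of \<open>{0..m} - {i}\<close>.
\<close>

definition L :: "nat \<Rightarrow> nat \<Rightarrow> 'p::prime_card mpol" where
  "L m i = Determinant.det (mat m m (\<lambda>(r, c). var c ^ (CARD('p) ^ (if r < i then r else Suc r))))"

text \<open>
  The type of polynomials has no division operation, so \<open>L m i / L m m\<close> is described as the
  polynomial \<open>q\<close> with \<open>q * L m m = L m i\<close>; it is unique because \<open>L m m\<close> is nonzero and the ring
  is an integral domain.
\<close>

definition dickson :: "nat \<Rightarrow> nat \<Rightarrow> 'p::prime_card mpol" where
  "dickson m i = (THE q. q * L m m = L m i)"

text \<open>
  Free module bases, for a subring \<open>D\<close> of the ambient ring and a \<open>D\<close>-submodule \<open>M\<close> of it.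
\<close>

definition lin_span :: "'a::comm_ring_1 set \<Rightarrow> 'a set \<Rightarrow> 'a set" where
  "lin_span D B = {\<Sum>b\<in>S. c b * b | S c. finite S \<and> S \<subseteq> B \<and> c ` S \<subseteq> D}"

definition lin_indep :: "'a::comm_ring_1 set \<Rightarrow> 'a set \<Rightarrow> bool" where
  "lin_indep D B \<longleftrightarrow>
     (\<forall>S c. finite S \<and> S \<subseteq> B \<and> c ` S \<subseteq> D \<and> (\<Sum>b\<in>S. c b * b) = 0 \<longrightarrow> (\<forall>b\<in>S. c b = 0))"

definition free_module_basis :: "'a::comm_ring_1 set \<Rightarrow> 'a set \<Rightarrow> 'a set \<Rightarrow> bool" where
  "free_module_basis D M B \<longleftrightarrow> B \<subseteq> M \<and> lin_span D B = M \<and> lin_indep D B"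

end

theory Submission
  imports Defs
begin

text \<open>
  Put \<open>m = n - 1\<close>, let \<open>W\<close> be the space of linear forms in \<open>y\<^sub>1, \<dots>, y\<^sub>m\<close>, and let
  \<open>\<Phi>\<^sub>m(X) = \<Prod>\<^bsub>u\<in>W\<^esub> (X - u) = \<Sum>\<^sub>i (-1)\<^bsup>m-i\<^esup> d\<^bsub>m,i\<^esub> X^(p^i)\<close>. Both sides of
  \<open>\<Phi>\<^bsub>m+1\<^esub> = \<Phi>\<^sub>m^p - v \<Phi>\<^sub>m\<close> with \<open>v = \<Phi>\<^sub>m(y\<^bsub>m+1\<^esub>)^(p-1)\<close> have the same roots, which gives
  \<open>d\<^bsub>m+1,i\<^esub> = d\<^bsub>m,i-1\<^esub>^p + v d\<^bsub>m,i\<^esub>\<close>.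

  Dividing by \<open>\<Phi>\<^sub>m\<close> shows that parabolic invariants are polynomials in \<open>v\<close> over the \<open>GL(m)\<close>-invariants.
  If the latter are generated by the \<open>d\<^bsub>m,i\<^esub>\<close>, then the recursion lets one rewrite
  every monomial in the \<open>d\<^bsub>m,i\<^esub>\<close> as a combination of the proposed basis with coefficients generated by the
  \<open>d\<^bsub>m+1,i\<^esub>\<close>. The basis is indexed by the hyperplanes of an
  \<open>(m+1)\<close>-dimensional space, and distinct hyperplanes give distinct characters of the parabolic
  invariants over the \<open>GL(m+1)\<close>-invariants, so by Dedekind's lemma a spanning set of this size is
  independent. Independence over all \<open>GL(m+1)\<close>-invariants in turn forces these to be generated by the
  \<open>d\<^bsub>m+1,i\<^esub>\<close>, which carries the induction on \<open>m\<close>.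
\<close>

hide_const (open) up_ring.coeff up_ring.monom

subsection \<open>Modules and polynomials over a subring\<close>

text \<open>Subtracting \<open>\<sigma> k g\<close> times the relation at \<open>f\<close> from the
  relation at \<open>g * f\<close> removes the term \<open>k\<close>. The induction hypothesis
  applies to the remaining coefficients, and a \<open>g\<close> that separates \<open>j\<close> from
  \<open>k\<close> gives \<open>r j = 0\<close>; evaluation at 1 then gives
  \<open>r k = 0\<close>.\<close>

lemma dedekind_independence:
  fixes \<sigma> :: "'i \<Rightarrow> 'a::monoid_mult \<Rightarrow> 'b::idom"
  assumes "finite J" and one: "1 \<in> M" and mult: "\<And>f g. f \<in> M \<Longrightarrow> g \<in> M \<Longrightarrow> f * g \<in> M"
    and hom1: "\<And>j. j \<in> J \<Longrightarrow> \<sigma> j 1 = 1"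
    and homm: "\<And>j f g. j \<in> J \<Longrightarrow> \<sigma> j (f * g) = \<sigma> j f * \<sigma> j g"
    and sep: "\<And>i j. i \<in> J \<Longrightarrow> j \<in> J \<Longrightarrow> i \<noteq> j \<Longrightarrow> \<exists>f\<in>M. \<sigma> i f \<noteq> \<sigma> j f"
    and rel: "\<And>f. f \<in> M \<Longrightarrow> (\<Sum>j\<in>J. r j * \<sigma> j f) = 0"
  shows "\<forall>j\<in>J. r j = 0"
  using \<open>finite J\<close> hom1 homm sep rel
proof (induction J arbitrary: r rule: finite_induct)
  case (insert k J)
  have "r j = 0" if j: "j \<in> J" for j
  proof -
    have "j \<noteq> k" using j insert.hyps by auto
    then obtain g where g: "g \<in> M" "\<sigma> j g \<noteq> \<sigma> k g"
      using insert.prems(3)[of j k] j by auto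
    have "\<forall>i\<in>J. r i * (\<sigma> i g - \<sigma> k g) = 0"
    proof (rule insert.IH)
      fix f assume f: "f \<in> M"
      have "(\<Sum>i\<in>insert k J. r i * (\<sigma> i g - \<sigma> k g) * \<sigma> i f) =
          (\<Sum>i\<in>insert k J. r i * \<sigma> i (g * f)) - \<sigma> k g * (\<Sum>i\<in>insert k J. r i * \<sigma> i f)"
        unfolding sum_distrib_left sum_subtractf[symmetric]
        by (intro sum.cong refl) (simp add: insert.prems(2) algebra_simps)
      also have "\<dots> = 0" using insert.prems(4) f g(1) mult by simp
      finally show "(\<Sum>i\<in>J. r i * (\<sigma> i g - \<sigma> k g) * \<sigma> i f) = 0"
        using insert.hyps by simp
    qed (use insert.prems in auto)
    then show ?thesis using j g(2) by auto
  qed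
  moreover from this have "r k = 0"
    using insert.prems(4)[OF one] insert.prems(1) insert.hyps by simp
  ultimately show ?case by simp
qed simp

text \<open>The characters are indexed by \<open>B\<close> itself, so the values
  \<open>\<sigma> b b'\<close> form a square matrix. A relation over \<open>D\<close> is a kernel
  vector of it, because the characters fix \<open>D\<close>. If it is nonzero, the transpose has a
  kernel vector too: a nontrivial combination of characters that is 0 on \<open>B\<close>, hence on
  \<open>M\<close>, against Dedekind's lemma.\<close>

lemma lin_indep_of_characters:
  fixes B M :: "'a::idom set"
  assumes fin: "finite B" and span: "M \<subseteq> lin_span D B" and D0: "0 \<in> D"
    and one: "1 \<in> M" and mult: "\<And>f g. f \<in> M \<Longrightarrow> g \<in> M \<Longrightarrow> f * g \<in> M"
    and hom: "\<And>b. b \<in> B \<Longrightarrow> comm_ring_hom (\<sigma> b)"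
    and fix_D: "\<And>b d. b \<in> B \<Longrightarrow> d \<in> D \<Longrightarrow> \<sigma> b d = d"
    and sep: "\<And>b b'. b \<in> B \<Longrightarrow> b' \<in> B \<Longrightarrow> b \<noteq> b' \<Longrightarrow> \<exists>f\<in>M. \<sigma> b f \<noteq> \<sigma> b' f"
  shows "lin_indep D B"
  unfolding lin_indep_def
proof (intro allI impI, elim conjE)
  fix S c
  assume S: "finite S" "S \<subseteq> B" "c ` S \<subseteq> D" and rel: "(\<Sum>b\<in>S. c b * b) = 0"
  have homD: "\<sigma> b (\<Sum>x\<in>T. d x * x) = (\<Sum>x\<in>T. d x * \<sigma> b x)"
    if "b \<in> B" "d ` T \<subseteq> D" for b d T
  proof -
    interpret comm_ring_hom "\<sigma> b" by (rule hom[OF that(1)])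
    have "\<sigma> b (\<Sum>x\<in>T. d x * x) = (\<Sum>x\<in>T. \<sigma> b (d x) * \<sigma> b x)"
      by (simp add: hom_distribs)
    also have "\<dots> = (\<Sum>x\<in>T. d x * \<sigma> b x)"
      by (intro sum.cong refl) (use that fix_D in auto)
    finally show ?thesis .
  qed
  define N where "N = card B"
  obtain h where h: "bij_betw h {0..<N} B"
    using ex_bij_betw_nat_finite[OF fin] N_def by auto
  have hB: "h i \<in> B" if "i < N" for i using h that by (auto simp: bij_betw_def)
  define A where "A = mat N N (\<lambda>(j, i). \<sigma> (h j) (h i))"
  have A: "A \<in> carrier_mat N N" by (simp add: A_def)
  \<comment> \<open>Extension by zero, since \<open>S\<close> may be smaller than the index set
    \<open>B\<close> of the matrix.\<close>
  define c' where "c' b = (if b \<in> S then c b else 0)" for b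
  define w where "w = vec N (\<lambda>i. c' (h i))"
  have "A *\<^sub>v w = 0\<^sub>v N"
  proof (rule eq_vecI)
    fix j assume "j < dim_vec (0\<^sub>v N :: 'a vec)"
    then have j: "j < N" by simp
    have "(A *\<^sub>v w) $ j = (\<Sum>i\<in>{0..<N}. c' (h i) * \<sigma> (h j) (h i))"
      using j by (simp add: A_def w_def scalar_prod_def mult.commute)
    also have "\<dots> = (\<Sum>b\<in>B. c' b * \<sigma> (h j) b)"
      by (rule sum.reindex_bij_betw[OF h])
    also have "\<dots> = (\<Sum>b\<in>S. c b * \<sigma> (h j) b)"
      by (rule sum.mono_neutral_cong_right) (use fin S c'_def in auto)
    also have "\<dots> = \<sigma> (h j) (\<Sum>b\<in>S. c b * b)" using homD[OF hB[OF j] S(3)] by simp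
    also have "\<dots> = 0"
    proof -
      interpret comm_ring_hom "\<sigma> (h j)" by (rule hom[OF hB[OF j]])
      show ?thesis by (simp add: rel)
    qed
    finally show "(A *\<^sub>v w) $ j = 0\<^sub>v N $ j" using j by simp
  qed (simp add: A_def)
  show "\<forall>b\<in>S. c b = 0"
  proof (rule ccontr)
    assume "\<not> (\<forall>b\<in>S. c b = 0)"
    then obtain b where b: "b \<in> S" "c b \<noteq> 0" by auto
    then obtain i where "i < N" "h i = b" using h S(2) by (auto simp: bij_betw_def)
    then have "w $ i \<noteq> 0" using b by (simp add: w_def c'_def)
    then have "w \<noteq> 0\<^sub>v N" using \<open>i < N\<close> by auto
    then have "det A = 0"
      using det_0_iff_vec_prod_zero[OF A] \<open>A *\<^sub>v w = 0\<^sub>v N\<close> vec_carrier[of N] w_def by metis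
    then have "det (transpose_mat A) = 0" using det_transpose[OF A] by simp
    then obtain r where r: "r \<in> carrier_vec N" "r \<noteq> 0\<^sub>v N" "transpose_mat A *\<^sub>v r = 0\<^sub>v N"
      using det_0_iff_vec_prod_zero[of "transpose_mat A" N] A by auto
    have col: "(\<Sum>j\<in>{0..<N}. r $ j * \<sigma> (h j) b) = 0" if b: "b \<in> B" for b
    proof -
      obtain i where i: "i < N" "h i = b" using h b by (auto simp: bij_betw_def)
      have "(transpose_mat A *\<^sub>v r) $ i = (\<Sum>j\<in>{0..<N}. r $ j * \<sigma> (h j) b)"
        using i r(1) by (simp add: A_def scalar_prod_def mult.commute)
      then show ?thesis using r(3) i by simp
    qed
    have "\<forall>j\<in>{0..<N}. r $ j = 0"
    proof (rule dedekind_independence[where \<sigma> = "\<lambda>j. \<sigma> (h j)" and M = M])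
      fix f assume "f \<in> M"
      then obtain T d where T: "finite T" "T \<subseteq> B" "d ` T \<subseteq> D" "f = (\<Sum>x\<in>T. d x * x)"
        using span by (auto simp: lin_span_def)
      have "(\<Sum>j\<in>{0..<N}. r $ j * \<sigma> (h j) f) =
          (\<Sum>j\<in>{0..<N}. \<Sum>x\<in>T. d x * (r $ j * \<sigma> (h j) x))"
        unfolding T(4) by (intro sum.cong refl)
          (simp add: homD[OF hB T(3)] sum_distrib_left mult.left_commute)
      also have "\<dots> = (\<Sum>x\<in>T. d x * (\<Sum>j\<in>{0..<N}. r $ j * \<sigma> (h j) x))"
        by (subst sum.swap) (simp add: sum_distrib_left)
      also have "\<dots> = 0" by (intro sum.neutral) (use col T(2) in auto)
      finally show "(\<Sum>j\<in>{0..<N}. r $ j * \<sigma> (h j) f) = 0" .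
    next
      fix i j assume ij: "i \<in> {0..<N}" "j \<in> {0..<N}" "i \<noteq> j"
      then have "h i \<noteq> h j" using h by (auto simp: bij_betw_def inj_on_def)
      then show "\<exists>f\<in>M. \<sigma> (h i) f \<noteq> \<sigma> (h j) f" using sep hB ij by auto
    next
      fix j assume "j \<in> {0..<N}"
      then interpret comm_ring_hom "\<sigma> (h j)" using hom hB by auto
      show "\<sigma> (h j) 1 = 1" by simp
      fix f g show "\<sigma> (h j) (f * g) = \<sigma> (h j) f * \<sigma> (h j) g" by (simp add: hom_distribs)
    qed (use one mult in auto)
    then have "r = 0\<^sub>v N" using r(1) by (intro eq_vecI) auto
    then show False using r(2) by simp
  qed
qed

section \<open>Subrings represented as sets\<close>

locale subring_set =
  fixes S :: "'a::comm_ring_1 set"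
  assumes one_closed: "1 \<in> S"
    and diff_closed: "a \<in> S \<Longrightarrow> b \<in> S \<Longrightarrow> a - b \<in> S"
    and mult_closed: "a \<in> S \<Longrightarrow> b \<in> S \<Longrightarrow> a * b \<in> S"
begin

lemma zero_closed: "0 \<in> S"
  using diff_closed[OF one_closed one_closed] by simp

lemma uminus_closed: "a \<in> S \<Longrightarrow> - a \<in> S"
  using diff_closed[OF zero_closed] by force

lemma add_closed: "a \<in> S \<Longrightarrow> b \<in> S \<Longrightarrow> a + b \<in> S"
  using diff_closed[OF _ uminus_closed] by force

lemma power_closed: "a \<in> S \<Longrightarrow> a ^ k \<in> S"
  by (induction k) (auto intro: one_closed mult_closed)

lemma sum_closed: "(\<And>i. i \<in> I \<Longrightarrow> f i \<in> S) \<Longrightarrow> sum f I \<in> S"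
  by (induction I rule: infinite_finite_induct) (auto intro: zero_closed add_closed)

lemma prod_closed: "(\<And>i. i \<in> I \<Longrightarrow> f i \<in> S) \<Longrightarrow> prod f I \<in> S"
  by (induction I rule: infinite_finite_induct) (auto intro: one_closed mult_closed)

lemma poly_closed: "(\<And>i. coeff F i \<in> S) \<Longrightarrow> x \<in> S \<Longrightarrow> poly F x \<in> S"
  by (simp add: poly_altdef sum_closed mult_closed power_closed)

lemmas coeff_mult_closed = coeff_mult_semiring_closed[OF zero_closed add_closed mult_closed]

lemmas coeff_pcompose_closed = coeff_pcompose_semiring_closed[OF zero_closed add_closed mult_closed]

lemma coeff_prod_closed:
  "(\<And>i k. i \<in> I \<Longrightarrow> coeff (f i) k \<in> S) \<Longrightarrow> coeff (prod f I) k \<in> S"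
  by (induction I arbitrary: k rule: infinite_finite_induct)
    (auto intro: one_closed zero_closed coeff_mult_closed simp: coeff_eq_0)

lemma coeff_synthetic_div_closed:
  assumes "\<And>i. coeff F i \<in> S" "u \<in> S"
  shows "coeff (synthetic_div F u) i \<in> S"
  using assms(1)
proof (induction F arbitrary: i)
  case (pCons a F)
  have F: "coeff F k \<in> S" for k using pCons.prems[of "Suc k"] by simp
  then show ?case using pCons.IH[OF F] poly_closed[OF F assms(2)]
    by (auto simp: coeff_pCons split: nat.splits)
qed (simp add: zero_closed)

end

section \<open>Products of linear factors with a prescribed root set\<close>

definition root_poly :: "'a::comm_ring_1 set \<Rightarrow> 'a poly" where
  "root_poly W = (\<Prod>u\<in>W. [:- u, 1:])"

lemma degree_root_poly: "degree (root_poly W :: 'a::idom poly) = card W"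
  by (cases "finite W") (auto simp: root_poly_def degree_prod_eq_sum_degree)

lemma lead_coeff_root_poly: "lead_coeff (root_poly W :: 'a::idom poly) = 1"
  by (simp add: root_poly_def lead_coeff_prod)

lemma poly_root_poly: "poly (root_poly W) x = (\<Prod>u\<in>W. x - u)"
  by (simp add: root_poly_def poly_prod)

lemma poly_root_poly_eq_0:
  fixes W :: "'a::idom set"
  shows "finite W \<Longrightarrow> poly (root_poly W) x = 0 \<longleftrightarrow> x \<in> W"
  by (auto simp: poly_root_poly)

lemma root_poly_neq_0: "root_poly W \<noteq> (0 :: 'a::idom poly)"
  using lead_coeff_root_poly[of W] by auto

text \<open>Translation by \<open>u\<close> maps the finite set \<open>W\<close> injectively into
  itself, so it permutes the roots.\<close>

lemma pcompose_root_poly: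
  assumes "\<And>v. v \<in> W \<Longrightarrow> v + u \<in> W" "finite (W :: 'a::idom set)"
  shows "pcompose (root_poly W) [:u, 1:] = root_poly W"
proof -
  have inj: "inj_on (\<lambda>v. v + u) W" by (auto simp: inj_on_def)
  have img: "(\<lambda>v. v + u) ` W = W"
    by (rule endo_inj_surj) (use assms inj in auto)
  have "root_poly W = (\<Prod>v\<in>W. [:- (v + u), 1:])"
    unfolding root_poly_def by (subst (1) img[symmetric]) (simp add: prod.reindex[OF inj])
  then have "pcompose (root_poly W) [:u, 1:] = (\<Prod>v\<in>W. pcompose [:- (v + u), 1:] [:u, 1:])"
    by (simp add: pcompose_prod)
  also have "\<dots> = root_poly W"
    by (simp add: root_poly_def pcompose_pCons)
  finally show ?thesis .
qed

lemma (in subring_set) coeff_root_poly_closed: "W \<subseteq> S \<Longrightarrow> coeff (root_poly W) i \<in> S"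
  unfolding root_poly_def
  by (rule coeff_prod_closed)
    (auto simp: coeff_pCons split: nat.splits intro: uminus_closed one_closed zero_closed)

text \<open>Linear factors are monic, so dividing them off one at a time keeps the coefficients in
  \<open>S\<close>; in a domain the remaining elements of \<open>W\<close> are roots of the
  quotient.\<close>

lemma root_poly_factor:
  fixes S :: "'a::idom set"
  assumes "subring_set S" "finite W" "W \<subseteq> S" "\<And>i. coeff F i \<in> S" "\<And>u. u \<in> W \<Longrightarrow> poly F u = 0"
  obtains Q where "\<And>i. coeff Q i \<in> S" "F = root_poly W * Q"
proof -
  interpret subring_set S by fact
  have "\<exists>Q. (\<forall>i. coeff Q i \<in> S) \<and> F = root_poly W * Q"
    using assms(2-)
  proof (induction W arbitrary: F rule: finite_induct)
    case empty
    then show ?case by (auto simp: root_poly_def)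
  next
    case (insert u W)
    define Q where "Q = synthetic_div F u"
    have F: "F = [:- u, 1:] * Q"
      using synthetic_div_correct'[of u F] insert.prems by (simp add: Q_def)
    have "poly Q u' = 0" if "u' \<in> W" for u'
      using insert.prems(3)[of u'] that insert.hyps by (auto simp: F)
    then obtain Q' where Q': "\<forall>i. coeff Q' i \<in> S" "Q = root_poly W * Q'"
      using insert.IH[of Q] coeff_synthetic_div_closed[of F u] insert.prems by (auto simp: Q_def)
    have "F = root_poly (insert u W) * Q'"
      unfolding F Q'(2) using insert.hyps by (simp add: root_poly_def mult_ac)
    then show ?case using Q' by blast
  qed
  then show ?thesis using that by blast
qed

text \<open>Invariance gives \<open>F\<close> the same value \<open>c\<close> at all points of
  \<open>W\<close>, so \<open>root_poly W\<close> divides \<open>F - c\<close>. The quotient is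
  again invariant, and of smaller degree because \<open>0 \<in> W\<close> makes
  \<open>card W\<close> positive. Iteration expands \<open>F\<close> in powers of
  \<open>root_poly W\<close>.\<close>

lemma translation_invariant_pcompose:
  fixes S :: "'a::idom set"
  assumes S: "subring_set S" and W: "finite W" "W \<subseteq> S" "0 \<in> W" "\<And>u v. u \<in> W \<Longrightarrow> v \<in> W \<Longrightarrow> v + u \<in> W"
    and F: "\<And>i. coeff F i \<in> S" "\<And>u. u \<in> W \<Longrightarrow> pcompose F [:u, 1:] = F"
  shows "\<exists>G. (\<forall>i. coeff G i \<in> S) \<and> F = pcompose G (root_poly W)"
  using F
proof (induction "degree F" arbitrary: F rule: less_induct)
  case less
  interpret subring_set S by fact
  define c where "c = coeff F 0"
  have c: "c \<in> S" using less.prems by (simp add: c_def)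
  show ?case
  proof (cases "degree F = 0")
    case True
    then have "F = [:c:]" by (simp add: c_def degree_0_id)
    moreover have "coeff [:c:] i \<in> S" for i using c zero_closed by (cases i) auto
    ultimately show ?thesis by (metis pcompose_const)
  next
    case False
    have root: "poly F u = c" if "u \<in> W" for u
    proof -
      have "poly (pcompose F [:u, 1:]) 0 = poly F 0" using less.prems(2)[OF that] by simp
      then show ?thesis by (simp add: poly_pcompose c_def poly_0_coeff_0)
    qed
    obtain Q where Q: "\<And>i. coeff Q i \<in> S" "F - [:c:] = root_poly W * Q"
    proof (rule root_poly_factor[OF S W(1,2), of "F - [:c:]"])
      show "coeff (F - [:c:]) i \<in> S" for i
        using less.prems(1) c by (auto simp: coeff_pCons intro!: diff_closed zero_closed split: nat.splits)
    qed (use root in auto)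
    have FQ: "F = [:c:] + root_poly W * Q" using Q(2) by (simp add: algebra_simps)
    have "Q \<noteq> 0" using FQ False by auto
    have "card W > 0" using W by (auto simp: card_gt_0_iff)
    have deg': "degree (root_poly W * Q) = card W + degree Q"
      by (simp add: degree_mult_eq root_poly_neq_0 \<open>Q \<noteq> 0\<close> degree_root_poly)
    have "degree F = card W + degree Q"
      using \<open>card W > 0\<close> by (subst FQ, subst degree_add_eq_right) (auto simp: deg')
    then have deg: "degree Q < degree F" using \<open>card W > 0\<close> by simp
    have inv: "pcompose Q [:u, 1:] = Q" if "u \<in> W" for u
    proof -
      have "pcompose F [:u, 1:] = [:c:] + pcompose (root_poly W) [:u, 1:] * pcompose Q [:u, 1:]"
        by (subst FQ) (simp add: pcompose_add pcompose_mult)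
      also have "pcompose (root_poly W) [:u, 1:] = root_poly W"
        by (rule pcompose_root_poly) (use W that in auto)
      finally have "root_poly W * pcompose Q [:u, 1:] = root_poly W * Q"
        using less.prems(2)[OF that] FQ by simp
      then show ?thesis using root_poly_neq_0[of W] by simp
    qed
    obtain G where G: "\<forall>i. coeff G i \<in> S" "Q = pcompose G (root_poly W)"
      using less.hyps[OF deg Q(1) inv] by blast
    have "F = pcompose (pCons c G) (root_poly W)"
      by (subst FQ) (simp add: G(2) pcompose_pCons)
    moreover have "\<forall>i. coeff (pCons c G) i \<in> S"
      using c G by (auto simp: coeff_pCons split: nat.splits)
    ultimately show ?thesis by blast
  qed
qed

text \<open>With \<open>x\<^sub>m = 1\<close> and \<open>x\<^bsub>-1\<^esub> = 0\<close>, the relations \<open>d\<^sub>i = x\<^bsub>i-1\<^esub>\<^sup>p + v x\<^sub>i\<close> give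
  \<open>x\<^sub>j\<^sup>p x\<^sub>t = d\<^bsub>j+1\<^esub> x\<^sub>t - d\<^sub>t x\<^bsub>j+1\<^esub> + x\<^bsub>j+1\<^esub> x\<^bsub>t-1\<^esub>\<^sup>p\<close>. For \<open>t \<le> j\<close> this rewrites a monomial in terms of
  monomials of smaller degree and one monomial whose least index is \<open>t - 1\<close>.\<close>

lemma monomial_in_submodule:
  fixes x :: "nat \<Rightarrow> 'a::comm_ring_1" and Sp :: "'a set"
  assumes add: "\<And>f g. f \<in> Sp \<Longrightarrow> g \<in> Sp \<Longrightarrow> f + g \<in> Sp"
    and smult: "\<And>d f. d \<in> D \<Longrightarrow> f \<in> Sp \<Longrightarrow> d * f \<in> Sp"
    and neg: "\<And>d. d \<in> D \<Longrightarrow> - d \<in> D" and zero: "0 \<in> Sp"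
    and xm: "x m = 1" and p: "p > 0"
    and rel0: "v * x 0 \<in> D"
    and rel: "\<And>i. i < m \<Longrightarrow> x i ^ p + v * x (Suc i) \<in> D"
    and reduced: "\<And>M. set_mset M \<subseteq> {..<m} \<Longrightarrow> (\<And>i. count M i < p) \<Longrightarrow> (\<Prod>i\<in>#M. x i) \<in> Sp"
    and reduced': "\<And>M t. set_mset M \<subseteq> {t..<m} \<Longrightarrow> t < m \<Longrightarrow> count M t = p \<Longrightarrow>
      (\<And>i. i \<noteq> t \<Longrightarrow> count M i < p) \<Longrightarrow> (\<Prod>i\<in>#M. x i) \<in> Sp"
    and M: "set_mset M \<subseteq> {..<m}"
  shows "(\<Prod>i\<in>#M. x i) \<in> Sp"
  using M
proof (induction "size M" arbitrary: M rule: less_induct)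
  case (less M)
  note IH = less.hyps
  have x_IH: "x j * (\<Prod>i\<in>#W. x i) \<in> Sp"
    if "j \<le> m" "set_mset W \<subseteq> {..<m}" "Suc (size W) < size M" for j W
  proof (cases "j = m")
    case True
    then show ?thesis using IH[of W] that xm by simp
  next
    case False
    then show ?thesis using IH[of "add_mset j W"] that by auto
  qed
  \<comment> \<open>Inner induction, among monomials of the same size, on an index \<open>t\<close>
    that occurs in \<open>N\<close> and bounds its indices from below.\<close>
  have "(\<Prod>i\<in>#N. x i) \<in> Sp"
    if "size N = size M" "set_mset N \<subseteq> {t..<m}" "t \<in># N" for t N
    using that
  proof (induction t arbitrary: N rule: less_induct)
    case (less t N)
    note N = less.prems and IHt = less.IH
    have tm: "t < m" using N by auto
    have Nm: "set_mset N \<subseteq> {..<m}" using N by auto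
    show ?case
    \<comment> \<open>The rewriting applies if \<open>N\<close> contains \<open>p\<close> copies of
      some \<open>j \<ge> t\<close> besides one copy of \<open>t\<close>; for \<open>j = t\<close>
      this means \<open>p + 1\<close> copies. Otherwise every index except \<open>t\<close> occurs
      fewer than \<open>p\<close> times and \<open>t\<close> at most \<open>p\<close> times, so the
      monomial is reduced.\<close>
    proof (cases "\<exists>j W. t \<le> j \<and> j < m \<and> N = replicate_mset p j + add_mset t W")
      case False
      have small: "count N i < p" if "i \<noteq> t" for i
      proof (rule ccontr)
        assume c: "\<not> count N i < p"
        then have i: "i \<in># N" using p by (metis gr0I not_less count_greater_zero_iff le_trans less_le_trans)
        have "replicate_mset p i \<subseteq># N - {#t#}"
          using c that by (simp add: count_le_replicate_mset_subset_eq[symmetric])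
        then have "N = replicate_mset p i + add_mset t ((N - {#t#}) - replicate_mset p i)"
          using N(3) by (metis add_mset_add_single insert_DiffM subset_mset.add_diff_inverse union_mset_add_mset_right)
        then show False using False N(2) i by (metis atLeastLessThan_iff subsetD)
      qed
      have "count N t \<le> p"
      proof (rule ccontr)
        assume c: "\<not> count N t \<le> p"
        have "replicate_mset p t \<subseteq># N - {#t#}"
          using c by (simp add: count_le_replicate_mset_subset_eq[symmetric])
        then have "N = replicate_mset p t + add_mset t ((N - {#t#}) - replicate_mset p t)"
          using N(3) by (metis add_mset_add_single insert_DiffM subset_mset.add_diff_inverse union_mset_add_mset_right)
        then show False using False tm by blast
      qed
      then consider "count N t = p" | "count N t < p" by linarith
      then show ?thesis
      proof cases
        case 1
        then show ?thesis using reduced'[of N t] N tm small by blast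
      next
        case 2
        then show ?thesis using reduced[of N] Nm small by metis
      qed
    next
      case True
      then obtain j W where j: "t \<le> j" "j < m" and NW: "N = replicate_mset p j + add_mset t W" by blast
      have W: "set_mset W \<subseteq> {t..<m}" "size W + p + 1 = size M"
        using N NW by auto
      define y where "y = (\<Prod>i\<in>#W. x i)"
      define dj where "dj = x j ^ p + v * x (Suc j)"
      \<comment> \<open>The \<open>p\<close>-th power of the entry before \<open>x t\<close>, read
        as 0 for \<open>t = 0\<close>.\<close>
      define z where "z = (if t = 0 then 0 else x (t - 1) ^ p)"
      define dt where "dt = z + v * x t"
      have "dj \<in> D" using rel j by (simp add: dj_def)
      have "dt \<in> D" using rel0 rel[of "t - 1"] tm by (cases t) (auto simp: dt_def z_def)
      have "(\<Prod>i\<in>#N. x i) = x j ^ p * (x t * y)"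
        by (simp add: NW y_def)
      also have "\<dots> = dj * (x t * y) + (- dt) * (x (Suc j) * y) + x (Suc j) * (z * y)"
        by (simp add: dj_def dt_def algebra_simps)
      also have "\<dots> \<in> Sp"
      proof (rule add, rule add)
        have "x t * y \<in> Sp" "x (Suc j) * y \<in> Sp"
          unfolding y_def using W tm j p by (auto intro!: x_IH)
        then show "dj * (x t * y) \<in> Sp" "- dt * (x (Suc j) * y) \<in> Sp"
          using smult neg \<open>dj \<in> D\<close> \<open>dt \<in> D\<close> by blast+
        show "x (Suc j) * (z * y) \<in> Sp"
        proof (cases t)
          case 0
          then show ?thesis using zero by (simp add: z_def)
        next
          case (Suc t')
          \<comment> \<open>\<open>add_mset (Suc j) U\<close> has the size of \<open>N\<close> but
            contains the smaller index \<open>t'\<close>, so the inner induction applies. For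
            \<open>Suc j = m\<close> the factor \<open>x m = 1\<close> drops out and the outer
            induction applies.\<close>
          define U where "U = replicate_mset p t' + W"
          have zy: "z * y = (\<Prod>i\<in>#U. x i)" by (simp add: z_def y_def U_def Suc)
          have U: "set_mset U \<subseteq> {t'..<m}" "Suc (size U) = size M" "t' \<in># U"
            using W Suc tm p by (auto simp: U_def)
          show ?thesis
          proof (cases "Suc j = m")
            case True
            have "set_mset U \<subseteq> {..<m}" using U by auto
            then show ?thesis using IH[of U] U zy True xm by simp
          next
            case False
            then show ?thesis using IHt[of t' "add_mset (Suc j) U"] U Suc j zy by auto
          qed
        qed
      qed
      finally show ?thesis .
    qed
  qed
  then have step: "(\<Prod>i\<in>#M. x i) \<in> Sp" if "set_mset M \<subseteq> {t..<m}" "t \<in># M" for t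
    using that by blast
  show ?case
  proof (cases "M = {#}")
    case True
    then show ?thesis using reduced[of "{#}"] p by simp
  next
    case False
    show ?thesis
    proof (rule step)
      show "Min (set_mset M) \<in># M" using False by simp
      show "set_mset M \<subseteq> {Min (set_mset M)..<m}" using less.prems by auto
    qed
  qed
qed

subsection \<open>The ring of polynomials over the prime field\<close>

lemma const_0 [simp]: "const 0 = 0"
  and const_1 [simp]: "const 1 = 1"
  and const_add: "const (a + b) = const a + const b"
  and const_mult: "const (a * b) = const a * const b"
  by (simp_all add: const_def single_add mult_single)

interpretation const_hom: comm_ring_hom "const :: 'p::prime_card mod_ring \<Rightarrow> 'p mpol"
  by unfold_locales (simp_all add: const_add const_mult)

lemma const_eq_0_iff [simp]: "const a = 0 \<longleftrightarrow> a = 0"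
  by (metis const_0 const_def lookup_single_eq)

section \<open>Substitution as a ring homomorphism\<close>

definition monomial_value :: "(nat \<Rightarrow> 'p::prime_card mpol) \<Rightarrow> (nat \<Rightarrow>\<^sub>0 nat) \<Rightarrow> 'p mpol" where
  "monomial_value g m = (\<Prod>k\<in>Poly_Mapping.keys m. g k ^ Poly_Mapping.lookup m k)"

lemma monomial_value_superset:
  assumes "finite K" "Poly_Mapping.keys m \<subseteq> K"
  shows "monomial_value g m = (\<Prod>k\<in>K. g k ^ Poly_Mapping.lookup m k)"
  unfolding monomial_value_def
  by (rule prod.mono_neutral_left) (use assms in \<open>auto simp: in_keys_iff\<close>)

lemma monomial_value_0 [simp]: "monomial_value g 0 = 1"
  by (simp add: monomial_value_def)

lemma monomial_value_add: "monomial_value g (a + b) = monomial_value g a * monomial_value g b"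
proof -
  let ?K = "Poly_Mapping.keys a \<union> Poly_Mapping.keys b"
  have "monomial_value g (a + b) = (\<Prod>k\<in>?K. g k ^ Poly_Mapping.lookup (a + b) k)"
    by (rule monomial_value_superset) (auto dest: keys_add[THEN subsetD])
  also have "\<dots> = monomial_value g a * monomial_value g b"
    by (simp add: monomial_value_superset[of ?K] lookup_add power_add prod.distrib)
  finally show ?thesis .
qed

lemma monomial_value_single [simp]: "monomial_value g (Poly_Mapping.single k e) = g k ^ e"
  by (cases "e = 0") (simp_all add: monomial_value_def)

lemma substitute_superset:
  assumes "finite K" "Poly_Mapping.keys f \<subseteq> K"
  shows "substitute g f = (\<Sum>m\<in>K. const (Poly_Mapping.lookup f m) * monomial_value g m)"
  unfolding substitute_def monomial_value_def
  by (rule sum.mono_neutral_left) (use assms in \<open>auto simp: in_keys_iff\<close>)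

lemma substitute_add: "substitute g (f + h) = substitute g f + substitute g h"
proof -
  let ?K = "Poly_Mapping.keys f \<union> Poly_Mapping.keys h"
  have "substitute g (f + h) = (\<Sum>m\<in>?K. const (Poly_Mapping.lookup (f + h) m) * monomial_value g m)"
    by (rule substitute_superset) (auto dest: keys_add[THEN subsetD])
  also have "\<dots> = substitute g f + substitute g h"
    by (simp add: substitute_superset[of ?K] lookup_add const_add distrib_right sum.distrib)
  finally show ?thesis .
qed

lemma substitute_0 [simp]: "substitute g 0 = 0"
  by (simp add: substitute_def)

lemma substitute_sum: "substitute g (sum f I) = (\<Sum>i\<in>I. substitute g (f i))"
  by (induction I rule: infinite_finite_induct) (simp_all add: substitute_add)

lemma substitute_single: "substitute g (Poly_Mapping.single m c) = const c * monomial_value g m"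
  by (cases "c = 0") (simp_all add: substitute_superset[of "{m}"])

lemma mpol_eq_sum_single:
  "f = (\<Sum>m\<in>Poly_Mapping.keys f. Poly_Mapping.single m (Poly_Mapping.lookup f m))"
  by (rule poly_mapping_eqI) (auto simp: lookup_sum lookup_single when_def in_keys_iff)

lemma substitute_mult: "substitute g (f * h) = substitute g f * substitute g h"
proof -
  let ?t = "\<lambda>f m. Poly_Mapping.single m (Poly_Mapping.lookup f m)"
  have "f * h = (\<Sum>a\<in>Poly_Mapping.keys f. \<Sum>b\<in>Poly_Mapping.keys h. ?t f a * ?t h b)"
    by (subst (1) mpol_eq_sum_single[of f], subst (1) mpol_eq_sum_single[of h]) (simp add: sum_product)
  then have "substitute g (f * h) =
      (\<Sum>a\<in>Poly_Mapping.keys f. \<Sum>b\<in>Poly_Mapping.keys h. substitute g (?t f a) * substitute g (?t h b))"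
    by (simp add: substitute_sum mult_single substitute_single const_mult monomial_value_add mult_ac)
  also have "\<dots> = substitute g (\<Sum>a\<in>Poly_Mapping.keys f. ?t f a) * substitute g (\<Sum>b\<in>Poly_Mapping.keys h. ?t h b)"
    by (simp only: substitute_sum sum_product)
  finally show ?thesis by (simp only: mpol_eq_sum_single[symmetric])
qed

lemma substitute_const [simp]: "substitute g (const c) = const c"
  by (simp add: const_def substitute_single)

lemma substitute_var [simp]: "substitute g (var k) = g k"
  by (simp add: var_def substitute_single)

interpretation substitute_hom: comm_ring_hom "substitute g" for g
proof
  show "substitute g 1 = 1" using substitute_const[of g 1] by (simp del: substitute_const)
qed (simp_all add: substitute_add substitute_mult)

lemma single_eq_monomial_value: "Poly_Mapping.single m c = const c * monomial_value (var :: nat \<Rightarrow> 'p::prime_card mpol) m"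
proof -
  have pow: "var k ^ e = (Poly_Mapping.single (Poly_Mapping.single k e) 1 :: 'p mpol)" for k e
    by (induction e) (simp_all add: var_def mult_single single_add[symmetric])
  have prod: "(\<Prod>k\<in>K. Poly_Mapping.single (h k) 1) = (Poly_Mapping.single (sum h K) 1 :: 'p mpol)"
    if "finite K" for K and h :: "nat \<Rightarrow> nat \<Rightarrow>\<^sub>0 nat"
    using that by (induction K rule: finite_induct) (simp_all add: mult_single)
  have "m = (\<Sum>k\<in>Poly_Mapping.keys m. Poly_Mapping.single k (Poly_Mapping.lookup m k))"
    by (rule poly_mapping_eqI) (auto simp: lookup_sum lookup_single when_def in_keys_iff)
  then have "monomial_value var m = (Poly_Mapping.single m 1 :: 'p mpol)"
    by (simp add: monomial_value_def pow prod)
  then show ?thesis by (simp add: const_def mult_single)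
qed

section \<open>Polynomials in the first \<open>n\<close> variables\<close>

lemma subring_set_poly_ring: "subring_set (poly_ring n)"
proof
  show "1 \<in> poly_ring n" by (simp add: poly_ring_def flip: single_one)
next
  fix a b :: "'a mpol" assume ab: "a \<in> poly_ring n" "b \<in> poly_ring n"
  have "Poly_Mapping.keys (a - b) \<subseteq> Poly_Mapping.keys a \<union> Poly_Mapping.keys b"
    by (auto simp: in_keys_iff lookup_minus)
  then show "a - b \<in> poly_ring n" using ab by (auto simp: poly_ring_def)
  show "a * b \<in> poly_ring n"
    unfolding poly_ring_def
  proof (intro CollectI ballI)
    fix m assume "m \<in> Poly_Mapping.keys (a * b)"
    then obtain k l where "m = k + l" "k \<in> Poly_Mapping.keys a" "l \<in> Poly_Mapping.keys b"
      using keys_mult[of a b] by blast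
    then show "Poly_Mapping.keys m \<subseteq> {..<n}"
      using ab keys_add[of k l] by (fastforce simp: poly_ring_def)
  qed
qed

interpretation poly_ring: subring_set "poly_ring n" for n
  by (rule subring_set_poly_ring)

lemma const_in_poly_ring [simp]: "const c \<in> poly_ring n"
  by (simp add: const_def poly_ring_def)

lemma var_in_poly_ring: "k < n \<Longrightarrow> var k \<in> poly_ring n"
  by (simp add: var_def poly_ring_def)

lemma poly_ring_mono: "m \<le> n \<Longrightarrow> poly_ring m \<subseteq> poly_ring n"
  by (force simp: poly_ring_def)

lemma poly_ring_induct [consumes 1, case_names const var add mult]:
  assumes f: "f \<in> poly_ring n" and const: "\<And>c. P (const c)" and var: "\<And>k. k < n \<Longrightarrow> P (var k)"
    and add: "\<And>f g. P f \<Longrightarrow> P g \<Longrightarrow> P (f + g)" and mult: "\<And>f g. P f \<Longrightarrow> P g \<Longrightarrow> P (f * g)"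
  shows "P f"
proof -
  have P1: "P 1" using const[of 1] by simp
  have P0: "P 0" using const[of 0] by simp
  have pow: "P (f ^ e)" if "P f" for f e
    by (induction e) (use P1 mult that in auto)
  have prod: "P (prod h K)" if "\<And>k. k \<in> K \<Longrightarrow> P (h k)" for h and K :: "nat set"
    using that by (induction K rule: infinite_finite_induct) (use P1 mult in auto)
  have sum: "P (sum h K)" if "\<And>k. k \<in> K \<Longrightarrow> P (h k)" for h and K :: "(nat \<Rightarrow>\<^sub>0 nat) set"
    using that by (induction K rule: infinite_finite_induct) (use P0 add in auto)
  have "P (\<Sum>m\<in>Poly_Mapping.keys f. const (Poly_Mapping.lookup f m) * monomial_value var m)"
    by (intro sum mult const, unfold monomial_value_def, intro prod pow var)
      (use f in \<open>auto simp: poly_ring_def\<close>)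
  also have "(\<Sum>m\<in>Poly_Mapping.keys f. const (Poly_Mapping.lookup f m) * monomial_value var m) = f"
    by (subst (3) mpol_eq_sum_single) (simp add: single_eq_monomial_value)
  finally show ?thesis .
qed

text \<open>Only the variables below \<open>n\<close> are compared, so that actions of matrices of
  different sizes can be identified on the smaller polynomial ring.\<close>

lemma hom_eq_on_poly_ring:
  assumes f: "f \<in> poly_ring n" and "comm_ring_hom h" "comm_ring_hom h'"
    and "\<And>c. h (const c) = h' (const c)" "\<And>k. k < n \<Longrightarrow> h (var k) = h' (var k)"
  shows "h f = h' f"
proof -
  interpret h: comm_ring_hom h by fact
  interpret h': comm_ring_hom h' by fact
  show ?thesis using f
    by (induction rule: poly_ring_induct) (use assms in \<open>auto simp: h.hom_add h'.hom_add h.hom_mult h'.hom_mult\<close>)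
qed

lemma substitute_in_poly_ring:
  assumes "f \<in> poly_ring n" "\<And>k. k < n \<Longrightarrow> g k \<in> poly_ring m"
  shows "substitute g f \<in> poly_ring m"
  using assms(1)
  by (induction rule: poly_ring_induct)
    (auto simp: assms(2) substitute_add substitute_mult intro: poly_ring.add_closed poly_ring.mult_closed)

lemma poly_ring_Suc_as_poly:
  assumes "f \<in> poly_ring (Suc m)"
  obtains F where "\<And>i. coeff F i \<in> poly_ring m" "f = poly F (var m)"
proof -
  have "\<exists>F. (\<forall>i. coeff F i \<in> poly_ring m) \<and> f = poly F (var m)"
    using assms
  proof (induction rule: poly_ring_induct)
    case (const c)
    show ?case
      by (rule exI[of _ "[:const c:]"]) (auto simp: coeff_pCons poly_ring.zero_closed split: nat.splits)
  next
    case (var k)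
    show ?case
    proof (cases "k = m")
      case True
      show ?thesis
        by (rule exI[of _ "[:0, 1:]"])
          (auto simp: True coeff_pCons poly_ring.zero_closed poly_ring.one_closed split: nat.splits)
    next
      case False
      then have "var k \<in> poly_ring m" using var by (simp add: var_in_poly_ring)
      then show ?thesis
        by (intro exI[of _ "[:var k:]"]) (auto simp: coeff_pCons poly_ring.zero_closed split: nat.splits)
    qed
  next
    case (add f g)
    then obtain F G where "\<forall>i. coeff F i \<in> poly_ring m" "f = poly F (var m)"
      "\<forall>i. coeff G i \<in> poly_ring m" "g = poly G (var m)" by blast
    then show ?case by (intro exI[of _ "F + G"]) (simp add: poly_ring.add_closed)
  next
    case (mult f g)
    then obtain F G where "\<forall>i. coeff F i \<in> poly_ring m" "f = poly F (var m)"
      "\<forall>i. coeff G i \<in> poly_ring m" "g = poly G (var m)" by blast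
    then show ?case by (intro exI[of _ "F * G"]) (simp add: poly_ring.coeff_mult_closed)
  qed
  then show ?thesis using that by blast
qed

lemma lookup_var: "Poly_Mapping.lookup (var l) (Poly_Mapping.single k 1) = (if l = k then 1 else 0)"
proof -
  have "Poly_Mapping.single l (1::nat) = Poly_Mapping.single k 1 \<longleftrightarrow> l = k"
    by (metis lookup_single_eq lookup_single_not_eq zero_neq_one)
  then show ?thesis by (simp add: var_def lookup_single when_def)
qed

lemma infinite_UNIV_mpol: "infinite (UNIV :: 'p::prime_card mpol set)"
proof
  assume "finite (UNIV :: 'p mpol set)"
  then have "finite (range (var :: nat \<Rightarrow> 'p mpol))" by (rule finite_subset[rotated]) auto
  moreover have "inj (var :: nat \<Rightarrow> 'p mpol)"
    by (metis injI lookup_var zero_neq_one)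
  ultimately show False using finite_imageD infinite_UNIV_nat by blast
qed

text \<open>Substituting arbitrary polynomials for \<open>var m\<close> gives \<open>F\<close> infinitely many roots.\<close>

lemma var_transcendental:
  assumes F: "\<And>i. coeff F i \<in> poly_ring m" and root: "poly F (var m) = 0"
  shows "F = 0"
proof (rule ccontr)
  assume "F \<noteq> 0"
  have "poly F t = 0" for t
  proof -
    define g where "g = var(m := t)"
    have "substitute g (coeff F i) = coeff F i" for i
      by (rule hom_eq_on_poly_ring[OF F, where h' = "\<lambda>x. x"])
        (auto simp: g_def intro!: substitute_hom.comm_ring_hom_axioms comm_ring_hom.intro ring_hom.intro
          semiring_hom.intro, (unfold_locales; simp)+)
    then have map: "map_poly (substitute g) F = F" by (intro poly_eqI) (simp add: coeff_map_poly)
    have "poly (map_poly (substitute g) F) (substitute g (var m)) = substitute g (poly F (var m))"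
      by (rule substitute_hom.poly_map_poly)
    then show ?thesis using map root by (simp add: g_def)
  qed
  then have "{t. poly F t = 0} = UNIV" by auto
  then show False using poly_roots_finite[OF \<open>F \<noteq> 0\<close>] infinite_UNIV_mpol by metis
qed

lemma poly_var_inject:
  assumes "\<And>i. coeff F i \<in> poly_ring m" "\<And>i. coeff G i \<in> poly_ring m"
    "poly F (var m) = poly G (var m)"
  shows "F = G"
proof -
  have "F - G = 0" by (rule var_transcendental[of _ m]) (use assms in \<open>auto intro: poly_ring.diff_closed\<close>)
  then show ?thesis by simp
qed

section \<open>Characteristic p and the Frobenius map\<close>

lemma CHAR_mpol: "CHAR('p::prime_card mpol) = CARD('p)"
proof (rule CHAR_eq_posI)
  have of_nat: "(of_nat k :: 'p mpol) = const (of_nat k)" for k by (simp add: const_hom.hom_of_nat)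
  show "of_nat CARD('p) = (0 :: 'p mpol)" by (simp add: of_nat)
  fix x :: nat assume "0 < x" "x < CARD('p)"
  then show "of_nat x \<noteq> (0 :: 'p mpol)"
    using of_nat_0_mod_ring_dvd[of x, where ?'a = 'p] nat_dvd_not_less by (auto simp: of_nat)
qed simp

text \<open>Multiplication by \<open>a\<close> permutes the nonzero residues, so it leaves their
  product unchanged.\<close>

lemma mod_ring_power_CARD_minus_1:
  fixes a :: "'p::prime_card mod_ring"
  assumes "a \<noteq> 0"
  shows "a ^ (CARD('p) - 1) = 1"
proof -
  let ?U = "UNIV - {0 :: 'p mod_ring}"
  have inj: "inj_on ((*) a) ?U" using assms by (auto simp: inj_on_def)
  have "(*) a ` ?U = ?U" by (rule endo_inj_surj[OF _ _ inj]) (use assms in auto)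
  then have "\<Prod>?U = (\<Prod>x\<in>?U. a * x)" using prod.reindex[OF inj, of "\<lambda>x. x"] by simp
  then have "\<Prod>?U = a ^ card ?U * \<Prod>?U" by (simp add: prod.distrib)
  moreover have "card ?U = CARD('p) - 1" by (simp add: card_Diff_singleton)
  moreover have "\<Prod>?U \<noteq> 0" by simp
  ultimately show ?thesis by simp
qed

lemma mod_ring_power_CARD: "(a :: 'p::prime_card mod_ring) ^ CARD('p) = a"
proof (cases "a = 0")
  case False
  have "a ^ CARD('p) = a * a ^ (CARD('p) - 1)" by (metis power_eq_if prime_card prime_gt_0_nat less_numeral_extra(3))
  then show ?thesis using mod_ring_power_CARD_minus_1[OF False] by simp
qed (use prime_gt_0_nat[OF prime_card] in auto)

lemma mod_ring_power_CARD_power: "(a :: 'p::prime_card mod_ring) ^ (CARD('p) ^ i) = a"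
  by (induction i) (simp_all add: power_mult mod_ring_power_CARD)

lemma frobenius_add:
  fixes a b :: "'p::prime_card mpol"
  shows "(a + b) ^ (CARD('p) ^ i) = a ^ (CARD('p) ^ i) + b ^ (CARD('p) ^ i)"
  by (rule freshmans_dream'[where n = i]) (simp_all add: CHAR_mpol prime_card)

subsection \<open>Linear forms and the Dickson invariants\<close>

lemma minus_one_power_cancel: "(-1) ^ k * ((-1) ^ k * x) = (x :: 'a::comm_ring_1)"
  by (cases "even k") simp_all

definition lin_form :: "nat \<Rightarrow> (nat \<Rightarrow> 'p::prime_card mod_ring) \<Rightarrow> 'p mpol" where
  "lin_form m c = (\<Sum>i<m. const (c i) * var i)"

definition lin_forms :: "nat \<Rightarrow> 'p::prime_card mpol set" where
  "lin_forms m = range (lin_form m)"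

lemma lookup_const_mult_var:
  "Poly_Mapping.lookup (const a * var l) (Poly_Mapping.single k 1) = (if l = k then a else 0)"
proof -
  have "Poly_Mapping.single l (1::nat) = Poly_Mapping.single k 1 \<longleftrightarrow> l = k"
    by (metis lookup_single_eq lookup_single_not_eq zero_neq_one)
  then show ?thesis by (simp add: const_def var_def mult_single lookup_single when_def)
qed

lemma lookup_lin_form: "k < m \<Longrightarrow> Poly_Mapping.lookup (lin_form m c) (Poly_Mapping.single k 1) = c k"
  by (simp add: lin_form_def lookup_sum lookup_const_mult_var del: One_nat_def)

lemma lin_form_in_poly_ring: "m \<le> n \<Longrightarrow> lin_form m c \<in> poly_ring n"
  unfolding lin_form_def
  by (intro poly_ring.sum_closed poly_ring.mult_closed) (auto intro: var_in_poly_ring)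

lemma lin_forms_subset: "lin_forms m \<subseteq> poly_ring m"
  by (auto simp: lin_forms_def lin_form_in_poly_ring)

lemma lin_form_cong: "(\<And>i. i < m \<Longrightarrow> c i = c' i) \<Longrightarrow> lin_form m c = lin_form m c'"
  by (simp add: lin_form_def)

lemma lin_form_add: "lin_form m c + lin_form m c' = lin_form m (\<lambda>i. c i + c' i)"
  by (simp add: lin_form_def const_add distrib_right sum.distrib)

lemma lin_form_scale: "const a * lin_form m c = lin_form m (\<lambda>i. a * c i)"
  by (simp add: lin_form_def const_mult sum_distrib_left mult_ac)

lemma lin_form_0 [simp]: "lin_form m (\<lambda>_. 0) = 0"
  by (simp add: lin_form_def)

lemma lin_form_Suc: "lin_form (Suc m) c = lin_form m c + const (c m) * var m"
  by (simp add: lin_form_def)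

lemma lin_forms_add: "u \<in> lin_forms m \<Longrightarrow> v \<in> lin_forms m \<Longrightarrow> u + v \<in> lin_forms m"
  by (auto simp: lin_forms_def lin_form_add)

lemma zero_in_lin_forms [simp]: "0 \<in> lin_forms m"
  unfolding lin_forms_def by (rule image_eqI[of _ _ "\<lambda>_. 0"]) auto

lemma lin_forms_bij_betw:
  "bij_betw (lin_form m) ({..<m} \<rightarrow>\<^sub>E UNIV) (lin_forms m :: 'p::prime_card mpol set)"
  unfolding bij_betw_def
proof
  show "inj_on (lin_form m) ({..<m} \<rightarrow>\<^sub>E UNIV)"
    by (rule inj_onI, erule (1) PiE_ext) (metis lessThan_iff lookup_lin_form)
  show "lin_form m ` ({..<m} \<rightarrow>\<^sub>E UNIV) = lin_forms m"
  proof
    show "lin_forms m \<subseteq> lin_form m ` ({..<m} \<rightarrow>\<^sub>E UNIV)"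
    proof
      fix u assume "u \<in> lin_forms m"
      then obtain c where "u = lin_form m c" by (auto simp: lin_forms_def)
      then have "u = lin_form m (restrict c {..<m})" by (auto intro: lin_form_cong)
      then show "u \<in> lin_form m ` ({..<m} \<rightarrow>\<^sub>E UNIV)" by auto
    qed
  qed (auto simp: lin_forms_def)
qed

lemma card_lin_forms: "card (lin_forms m :: 'p::prime_card mpol set) = CARD('p) ^ m"
  using bij_betw_same_card[OF lin_forms_bij_betw[where 'p = 'p]] by (simp add: card_PiE)

lemma finite_lin_forms [simp]: "finite (lin_forms m :: 'p::prime_card mpol set)"
  using bij_betw_finite[OF lin_forms_bij_betw[where 'p = 'p]] by (simp add: finite_PiE)

lemma CARD_prime_gt_1: "CARD('p::prime_card) > 1"
  using prime_gt_1_nat[OF prime_card] .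

text \<open>Linearised polynomials: all exponents are powers of \<open>p\<close>, so evaluation is
  linear over the prime field and the roots are closed under linear combinations.\<close>

definition frobenius_poly :: "nat \<Rightarrow> (nat \<Rightarrow> 'p::prime_card mpol) \<Rightarrow> 'p mpol poly" where
  "frobenius_poly m e = (\<Sum>i\<le>m. monom (e i) (CARD('p) ^ i))"

lemma coeff_frobenius_poly:
  "coeff (frobenius_poly m (e :: nat \<Rightarrow> 'p::prime_card mpol)) (CARD('p) ^ i) = (if i \<le> m then e i else 0)"
  using CARD_prime_gt_1[where 'p = 'p] by (simp add: frobenius_poly_def coeff_sum power_inject_exp)

lemma degree_frobenius_poly: "degree (frobenius_poly m (e :: nat \<Rightarrow> 'p::prime_card mpol)) \<le> CARD('p) ^ m"
  unfolding frobenius_poly_def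
  by (rule degree_sum_le, simp, rule order_trans[OF degree_monom_le])
    (use CARD_prime_gt_1[where 'p = 'p] in \<open>auto intro: power_increasing\<close>)

lemma poly_frobenius_poly_add:
  "poly (frobenius_poly m e) (a + b) = poly (frobenius_poly m e) a + poly (frobenius_poly m e) b"
  by (simp add: frobenius_poly_def poly_sum poly_monom frobenius_add distrib_left sum.distrib)

lemma poly_frobenius_poly_scale:
  "poly (frobenius_poly m e) (const c * a) = const c * poly (frobenius_poly m e) a"
proof -
  have "const c ^ (CARD('a) ^ i) = const c" for i
    by (simp add: mod_ring_power_CARD_power flip: const_hom.hom_power)
  then show ?thesis
    by (simp add: frobenius_poly_def poly_sum poly_monom power_mult_distrib sum_distrib_left mult_ac)
qed

lemma poly_frobenius_poly_lin_form:
  assumes "\<And>k. k < m \<Longrightarrow> poly (frobenius_poly n e) (var k) = 0"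
  shows "poly (frobenius_poly n e) (lin_form m c) = 0"
  using assms
proof (induction m)
  case 0
  have "poly (frobenius_poly n e) (const 0 * 0) = const 0 * poly (frobenius_poly n e) 0"
    by (rule poly_frobenius_poly_scale)
  then show ?case by (simp add: lin_form_def)
qed (simp add: lin_form_Suc poly_frobenius_poly_add poly_frobenius_poly_scale)

text \<open>The Moore matrix of the first \<open>m\<close> variables and \<open>t\<close>. Expansion
  along its last column gives a linearised polynomial in \<open>t\<close> whose coefficients are the
  signed minors \<open>L m i\<close>.\<close>

definition bordered :: "nat \<Rightarrow> 'p::prime_card mpol \<Rightarrow> 'p mpol mat" where
  "bordered m t = mat (Suc m) (Suc m) (\<lambda>(r, c). (if c < m then var c else t) ^ (CARD('p) ^ r))"

lemma det_bordered:
  "det (bordered m t) = poly (frobenius_poly m (\<lambda>i. (-1) ^ (m + i) * L m i)) (t :: 'p::prime_card mpol)"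
proof -
  have "det (bordered m t) = (\<Sum>i<Suc m. bordered m t $$ (i, m) * cofactor (bordered m t) i m)"
    by (rule laplace_expansion_column) (simp_all add: bordered_def)
  also have "\<dots> = (\<Sum>i\<le>m. (-1) ^ (m + i) * L m i * t ^ (CARD('p) ^ i))"
    unfolding lessThan_Suc_atMost
  proof (intro sum.cong refl)
    fix i assume i: "i \<in> {..m}"
    have "mat_delete (bordered m t) i m =
        mat m m (\<lambda>(r, c). var c ^ (CARD('p) ^ (if r < i then r else Suc r)))"
      by (rule eq_matI) (auto simp: mat_delete_def bordered_def)
    then show "bordered m t $$ (i, m) * cofactor (bordered m t) i m =
        (-1) ^ (m + i) * L m i * t ^ (CARD('p) ^ i)"
      using i by (simp add: cofactor_def L_def bordered_def add.commute mult_ac)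
  qed
  finally show ?thesis by (simp add: frobenius_poly_def poly_sum poly_monom)
qed

text \<open>This is \<open>\<Phi>\<^sub>m\<close> of the opening overview.\<close>

definition forms_poly :: "nat \<Rightarrow> 'p::prime_card mpol poly" where
  "forms_poly m = root_poly (lin_forms m)"

lemma degree_forms_poly: "degree (forms_poly m :: 'p::prime_card mpol poly) = CARD('p) ^ m"
  by (simp add: forms_poly_def degree_root_poly card_lin_forms)

lemma lead_coeff_forms_poly: "coeff (forms_poly m :: 'p::prime_card mpol poly) (CARD('p) ^ m) = 1"
  using lead_coeff_root_poly[of "lin_forms m :: 'p mpol set"]
  by (simp add: forms_poly_def degree_root_poly card_lin_forms)

lemma poly_forms_poly_eq_0: "poly (forms_poly m) u = 0 \<longleftrightarrow> u \<in> lin_forms m"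
  by (simp add: forms_poly_def poly_root_poly_eq_0)

lemma coeff_forms_poly_in_poly_ring: "coeff (forms_poly m) i \<in> poly_ring m"
  unfolding forms_poly_def by (rule poly_ring.coeff_root_poly_closed[OF lin_forms_subset])

text \<open>Both sides have degree at most \<open>p ^ m\<close> and the same coefficient there, so
  agreement at the \<open>p ^ m\<close> linear forms suffices. At a variable,
  \<open>bordered\<close> has two equal columns, and linearity extends the vanishing to all
  forms.\<close>

lemma frobenius_poly_L:
  "frobenius_poly m (\<lambda>i. (-1) ^ (m + i) * L m i) = smult (L m m) (forms_poly m :: 'p::prime_card mpol poly)"
proof (rule poly_eqI_degree_lead_coeff[where n = "CARD('p) ^ m" and A = "lin_forms m"])
  let ?F = "frobenius_poly m (\<lambda>i. (-1) ^ (m + i) * L m i) :: 'p mpol poly"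
  show "coeff ?F (CARD('p) ^ m) = coeff (smult (L m m) (forms_poly m)) (CARD('p) ^ m)"
    by (simp add: coeff_frobenius_poly lead_coeff_forms_poly)
  fix u :: "'p mpol" assume u: "u \<in> lin_forms m"
  have "poly ?F (var k) = 0" if k: "k < m" for k
  proof -
    have "det (bordered m (var k :: 'p mpol)) = 0"
    proof (rule det_identical_columns[of _ "Suc m" k m])
      show "col (bordered m (var k)) k = col (bordered m (var k :: 'p mpol)) m"
        using k by (intro eq_vecI) (auto simp: bordered_def)
    qed (use k in \<open>auto simp: bordered_def\<close>)
    then show ?thesis by (simp add: det_bordered)
  qed
  then show "poly ?F u = poly (smult (L m m) (forms_poly m)) u"
    using u by (auto simp: poly_forms_poly_eq_0 lin_forms_def poly_frobenius_poly_lin_form)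
qed (auto simp: card_lin_forms degree_frobenius_poly degree_forms_poly intro: order_trans[OF degree_smult_le])

text \<open>Bordering by the next variable gives the Moore matrix of size \<open>m + 1\<close>. This
  is one step of Moore's product formula and leads to \<open>L_neq_0\<close>.\<close>

lemma L_Suc: "L (Suc m) (Suc m) = L m m * poly (forms_poly m) (var m :: 'p::prime_card mpol)"
proof -
  have "bordered m (var m) = mat (Suc m) (Suc m)
      (\<lambda>(r, c). var c ^ (CARD('p) ^ (if r < Suc m then r else Suc r)) :: 'p mpol)"
    by (rule eq_matI) (auto simp: bordered_def less_Suc_eq)
  then have "L (Suc m) (Suc m) = det (bordered m (var m :: 'p mpol))"
    by (simp add: L_def)
  then show ?thesis by (simp add: det_bordered frobenius_poly_L)
qed

lemma var_notin_poly_ring: "var m \<notin> poly_ring m"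
  by (simp add: var_def poly_ring_def)

lemma poly_forms_poly_var_neq_0: "poly (forms_poly m) (var m) \<noteq> 0"
  using var_notin_poly_ring[of m] lin_forms_subset[of m] by (auto simp: poly_forms_poly_eq_0)

lemma L_neq_0: "L m m \<noteq> 0"
proof (induction m)
  case 0
  show ?case by (simp add: L_def)
next
  case (Suc m)
  then show ?case by (simp add: L_Suc poly_forms_poly_var_neq_0)
qed

lemma minus_one_power_power_CARD: "((-1) ^ k) ^ CARD('p) = ((-1) ^ k :: 'p::prime_card mpol)"
proof -
  have "((-1) ^ k :: 'p mpol) = const ((-1) ^ k)" by (simp add: const_hom.hom_power const_hom.hom_uminus)
  then show ?thesis by (simp only: mod_ring_power_CARD flip: const_hom.hom_power)
qed

text \<open>Comparing coefficients in \<open>frobenius_poly_L\<close> exhibits the quotient, and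
  \<open>L_neq_0\<close> makes it unique. From here on Dickson invariants are handled as
  coefficients of \<open>forms_poly\<close> rather than through determinants.\<close>

lemma dickson_eq_coeff:
  assumes "i \<le> m"
  shows "dickson m i = (-1) ^ (m + i) * coeff (forms_poly m :: 'p::prime_card mpol poly) (CARD('p) ^ i)"
proof -
  let ?q = "(-1) ^ (m + i) * coeff (forms_poly m :: 'p mpol poly) (CARD('p) ^ i)"
  have "(-1) ^ (m + i) * L m i = L m m * coeff (forms_poly m :: 'p mpol poly) (CARD('p) ^ i)"
    using arg_cong[OF frobenius_poly_L[of m, where 'p = 'p], of "\<lambda>F. coeff F (CARD('p) ^ i)"] assms
    by (simp add: coeff_frobenius_poly)
  then have "(-1) ^ (m + i) * ((-1) ^ (m + i) * L m i) = ?q * L m m" by (simp add: mult_ac)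
  then have q: "?q * L m m = L m i" by (simp only: minus_one_power_cancel)
  show ?thesis
    unfolding dickson_def
  proof (rule the_equality)
    show "?q * L m m = L m i" by (rule q)
  next
    fix q' :: "'p mpol" assume "q' * L m m = L m i"
    then have "q' * L m m = ?q * L m m" by (simp only: q)
    then show "q' = ?q" using L_neq_0[of m, where 'a = 'p] by simp
  qed
qed

lemma dickson_self [simp]: "dickson m m = 1"
  by (simp add: dickson_eq_coeff lead_coeff_forms_poly)

lemma coeff_forms_poly:
  assumes "i \<le> m"
  shows "coeff (forms_poly m :: 'p::prime_card mpol poly) (CARD('p) ^ i) = (-1) ^ (m + i) * dickson m i"
  by (simp only: dickson_eq_coeff[OF assms] minus_one_power_cancel)

text \<open>Cancelling \<open>L m m\<close> shows that \<open>forms_poly m\<close> is itself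
  linearised, so additivity and scaling hold for it.\<close>

lemma forms_poly_eq: "forms_poly m = frobenius_poly m (\<lambda>i. (-1) ^ (m + i) * dickson m i)"
proof -
  have "smult (L m m) (frobenius_poly m (\<lambda>i. (-1) ^ (m + i) * dickson m i)) =
      frobenius_poly m (\<lambda>i. (-1) ^ (m + i) * L m i :: 'a mpol)"
  proof -
    have "L m m * ((-1) ^ (m + i) * dickson m i) = ((-1) ^ (m + i) * L m i :: 'a mpol)" if "i \<le> m" for i
      using arg_cong[OF frobenius_poly_L[of m, where 'p = 'a], of "\<lambda>F. coeff F (CARD('a) ^ i)"] that
      by (simp add: coeff_frobenius_poly coeff_forms_poly)
    then show ?thesis by (auto simp: frobenius_poly_def smult_sum2 smult_monom intro!: sum.cong)
  qed
  then have "smult (L m m) (forms_poly m - frobenius_poly m (\<lambda>i. (-1) ^ (m + i) * dickson m i) :: 'a mpol poly) = 0"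
    by (simp add: frobenius_poly_L smult_diff_right)
  then show ?thesis using L_neq_0[of m, where 'a = 'a] by simp
qed

text \<open>The \<open>v\<close> of the opening overview. A scaling of the new variable by
  \<open>b \<noteq> 0\<close> multiplies the base by \<open>b\<close>, which the exponent
  \<open>p - 1\<close> cancels.\<close>

definition top_form :: "nat \<Rightarrow> 'p::prime_card mpol" where
  "top_form m = poly (forms_poly m) (var m) ^ (CARD('p) - 1)"

text \<open>On a form \<open>w + c y\<close>, with \<open>w\<close> in the first \<open>m\<close>
  variables and \<open>y\<close> the new one, linearity gives \<open>\<Phi>\<^sub>m = c V\<close>
  for \<open>V = \<Phi>\<^sub>m(y)\<close>; then \<open>(c V)^p - V^(p-1) c V = 0\<close> because
  \<open>c^p = c\<close>. Degree bounds and top coefficients agree as well.\<close>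

lemma forms_poly_Suc:
  "forms_poly (Suc m) = forms_poly m ^ CARD('p) - smult (top_form m) (forms_poly m :: 'p::prime_card mpol poly)"
proof (rule poly_eqI_degree_lead_coeff[where n = "CARD('p) ^ Suc m" and A = "lin_forms (Suc m)"])
  let ?\<Phi> = "forms_poly m :: 'p mpol poly"
  let ?p = "CARD('p)"
  have lt: "?p ^ m < ?p ^ Suc m" using CARD_prime_gt_1[where 'p = 'p] by simp
  have deg: "degree (?\<Phi> ^ ?p) = ?p ^ Suc m"
    by (simp add: degree_power_eq forms_poly_def root_poly_neq_0 degree_root_poly card_lin_forms mult.commute)
  have "lead_coeff (?\<Phi> ^ ?p) = 1"
    by (simp add: lead_coeff_power forms_poly_def lead_coeff_root_poly)
  then have "coeff (?\<Phi> ^ ?p) (?p ^ Suc m) = 1" using deg by simp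
  moreover have "coeff ?\<Phi> (?p ^ Suc m) = 0" using lt by (simp add: coeff_eq_0 degree_forms_poly)
  ultimately show "coeff (forms_poly (Suc m)) (?p ^ Suc m) =
      coeff (?\<Phi> ^ ?p - smult (top_form m) ?\<Phi>) (?p ^ Suc m)"
    using lead_coeff_forms_poly[of "Suc m", where 'p = 'p] by simp
  show "degree (?\<Phi> ^ ?p - smult (top_form m) ?\<Phi>) \<le> ?p ^ Suc m"
    by (rule degree_diff_le)
      (use deg lt in \<open>auto intro!: order_trans[OF degree_smult_le] simp: degree_forms_poly simp del: power_Suc\<close>)
  fix u :: "'p mpol" assume u: "u \<in> lin_forms (Suc m)"
  then obtain c where c: "u = lin_form m c + const (c m) * var m"
    by (auto simp: lin_forms_def lin_form_Suc)
  let ?V = "poly ?\<Phi> (var m)"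
  have "poly ?\<Phi> (lin_form m c) = 0" by (simp add: poly_forms_poly_eq_0 lin_forms_def)
  then have "poly ?\<Phi> u = const (c m) * ?V"
    unfolding c by (simp add: forms_poly_eq poly_frobenius_poly_add poly_frobenius_poly_scale)
  moreover have "const (c m) ^ ?p = const (c m)"
    by (simp add: mod_ring_power_CARD flip: const_hom.hom_power)
  moreover have "?V ^ ?p = ?V ^ (?p - 1) * ?V"
    using CARD_prime_gt_1[where 'p = 'p] by (metis less_trans mult.commute power_eq_if zero_less_one not_less0)
  ultimately have "poly (?\<Phi> ^ ?p - smult (top_form m) ?\<Phi>) u = 0"
    by (simp add: top_form_def power_mult_distrib mult_ac)
  then show "poly (forms_poly (Suc m)) u = poly (?\<Phi> ^ ?p - smult (top_form m) ?\<Phi>) u"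
    using u poly_forms_poly_eq_0[of "Suc m" u] by simp
qed (simp_all add: card_lin_forms degree_forms_poly)

lemma frobenius_poly_power_CARD:
  "frobenius_poly m e ^ CARD('p) =
    (\<Sum>i\<le>m. monom (e i ^ CARD('p)) (CARD('p) ^ Suc i) :: 'p::prime_card mpol poly)"
  by (simp add: frobenius_poly_def freshmans_dream_sum CHAR_mpol prime_card monom_power mult.commute)

text \<open>All exponents in the \<open>p\<close>-th power of \<open>forms_poly m\<close> are at
  least \<open>p\<close>, so only the other term contributes to the linear coefficient.\<close>

lemma dickson_Suc_0: "dickson (Suc m) 0 = top_form m * (dickson m 0 :: 'p::prime_card mpol)"
proof -
  have "coeff (forms_poly m ^ CARD('p)) (CARD('p) ^ 0) = (0 :: 'p mpol)"
    using CARD_prime_gt_1[where 'p = 'p]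
    by (simp add: forms_poly_eq frobenius_poly_power_CARD coeff_sum)
  then have "coeff (forms_poly (Suc m) :: 'p mpol poly) (CARD('p) ^ 0) =
      - top_form m * coeff (forms_poly m) (CARD('p) ^ 0)"
    by (simp add: forms_poly_Suc)
  then show ?thesis by (simp add: dickson_eq_coeff mult_ac)
qed

text \<open>The \<open>p\<close>-th power moves the exponent \<open>p^i\<close> to
  \<open>p^(i+1)\<close> and fixes the sign, which lies in the prime field.\<close>

lemma dickson_Suc_Suc:
  assumes "i < m"
  shows "dickson (Suc m) (Suc i) = dickson m i ^ CARD('p) + top_form m * (dickson m (Suc i) :: 'p::prime_card mpol)"
proof -
  have "coeff (forms_poly m ^ CARD('p)) (CARD('p) ^ Suc i) =
      (((-1) ^ (m + i) * dickson m i) ^ CARD('p) :: 'p mpol)"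
    using CARD_prime_gt_1[where 'p = 'p] assms
    by (simp add: forms_poly_eq frobenius_poly_power_CARD coeff_sum power_inject_exp del: power_Suc)
  also have "\<dots> = (-1) ^ (m + i) * dickson m i ^ CARD('p)"
    by (simp add: power_mult_distrib minus_one_power_power_CARD)
  finally have "coeff (forms_poly (Suc m) :: 'p mpol poly) (CARD('p) ^ Suc i) =
      (-1) ^ (m + i) * dickson m i ^ CARD('p) - top_form m * ((-1) ^ (m + Suc i) * dickson m (Suc i))"
    using assms coeff_forms_poly[of "Suc i" m, where 'p = 'p] by (simp add: forms_poly_Suc del: power_Suc)
  also have "\<dots> = (-1) ^ (m + i) * (dickson m i ^ CARD('p) + top_form m * dickson m (Suc i))"
    by (simp add: algebra_simps)
  finally have "dickson (Suc m) (Suc i) = (-1) ^ (Suc m + Suc i) *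
      ((-1) ^ (m + i) * (dickson m i ^ CARD('p) + top_form m * (dickson m (Suc i) :: 'p mpol)))"
    using assms dickson_eq_coeff[of "Suc i" "Suc m", where 'p = 'p] by simp
  also have "(-1) ^ (Suc m + Suc i) = ((-1) ^ (m + i) :: 'p mpol)" by simp
  finally show ?thesis by (simp only: minus_one_power_cancel)
qed

subsection \<open>Invariants of the parabolic subgroup\<close>

lemma act_hom: "comm_ring_hom (act A)"
  unfolding act_def by (rule substitute_hom.comm_ring_hom_axioms)

interpretation act_hom: comm_ring_hom "act A" for A
  by (rule act_hom)

lemma act_const [simp]: "act A (const c) = const c"
  by (simp add: act_def)

lemma act_var: "act A (var k) = lin_form (dim_row A) (\<lambda>i. A $$ (i, k))"
  by (simp add: act_def lin_form_def)

lemma sum_lin_form: "(\<Sum>l\<in>K. lin_form n (c l)) = lin_form n (\<lambda>i. \<Sum>l\<in>K. c l i)"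
  by (induction K rule: infinite_finite_induct) (simp_all add: lin_form_add)

lemma act_lin_form:
  "act A (lin_form m c) = lin_form (dim_row A) (\<lambda>i. \<Sum>l<m. c l * A $$ (i, l))"
proof -
  have "act A (lin_form m c) = (\<Sum>l<m. const (c l) * act A (var l))"
    by (simp add: lin_form_def act_hom.hom_sum act_hom.hom_mult)
  then show ?thesis by (simp add: act_var lin_form_scale sum_lin_form)
qed

lemma var_eq_lin_form: "k < n \<Longrightarrow> var k = lin_form n (\<lambda>i. if i = k then 1 else 0)"
proof -
  assume k: "k < n"
  have "lin_form n (\<lambda>i. if i = k then 1 else 0) = (\<Sum>i<n. if i = k then var i else 0)"
    unfolding lin_form_def by (rule sum.cong) auto
  also have "\<dots> = var k" using k by simp
  finally show ?thesis by (rule sym)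
qed

lemma act_mult:
  assumes "f \<in> poly_ring n" "A \<in> carrier_mat n n" "B \<in> carrier_mat n n"
  shows "act A (act B f) = act (A * B) f"
proof (rule hom_eq_on_poly_ring[OF assms(1), of "\<lambda>f. act A (act B f)"])
  show "comm_ring_hom (\<lambda>f. act A (act B f))"
    by unfold_locales (simp_all add: act_hom.hom_add act_hom.hom_mult)
  fix k assume k: "k < n"
  have "act A (act B (var k)) = lin_form n (\<lambda>i. \<Sum>l<n. B $$ (l, k) * A $$ (i, l))"
    using assms(2,3) by (simp add: act_var act_lin_form)
  also have "\<dots> = lin_form n (\<lambda>i. (A * B) $$ (i, k))"
    by (rule lin_form_cong)
      (use assms(2,3) k in \<open>simp add: scalar_prod_def atLeast0LessThan mult.commute\<close>)
  also have "\<dots> = act (A * B) (var k)" using assms(2) by (simp add: act_var)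
  finally show "act A (act B (var k)) = act (A * B) (var k)" .
qed (simp_all add: act_hom)

lemma act_one:
  assumes "f \<in> poly_ring n"
  shows "act (1\<^sub>m n) f = f"
proof (rule hom_eq_on_poly_ring[OF assms, where h' = "\<lambda>f. f"])
  show "comm_ring_hom (\<lambda>f :: 'a mpol. f)" by unfold_locales simp_all
  fix k assume k: "k < n"
  have "act (1\<^sub>m n) (var k) = lin_form n (\<lambda>i. if i = k then 1 else 0)"
    unfolding act_var index_one_mat(2) by (rule lin_form_cong) (use k in simp)
  then show "act (1\<^sub>m n) (var k) = var k" by (simp only: var_eq_lin_form[OF k, symmetric])
qed (simp_all add: act_hom)

lemma GL_iff_det: "A \<in> GL n \<longleftrightarrow> A \<in> carrier_mat n n \<and> det A \<noteq> 0"
proof (intro iffI conjI; (elim conjE)?)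
  assume A: "A \<in> GL n"
  then show A': "A \<in> carrier_mat n n" by (simp add: GL_def)
  obtain B where B: "inverts_mat A B" "inverts_mat B A" using A by (auto simp: GL_def invertible_mat_def)
  then have AB: "A * B = 1\<^sub>m n" using A' by (simp add: inverts_mat_def)
  have "dim_col B = n" using arg_cong[OF AB, of dim_col] by simp
  moreover have "dim_row B = n"
    using arg_cong[OF B(2)[unfolded inverts_mat_def], of dim_col] A' by simp
  ultimately have "B \<in> carrier_mat n n" by auto
  then have "det A * det B = det (A * B)" using det_mult[OF A', of B] by simp
  then have "det A * det B = 1" by (simp add: AB)
  then show "det A \<noteq> 0" by auto
next
  assume A: "A \<in> carrier_mat n n" and det: "det A \<noteq> 0"
  then obtain B where "B \<in> carrier_mat n n" "A * B = 1\<^sub>m n" "B * A = 1\<^sub>m n"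
    using det_non_zero_imp_unit[OF A det, of "()"] by (auto simp: Units_def ring_mat_def)
  then show "A \<in> GL n" using A by (auto simp: GL_def invertible_mat_def inverts_mat_def)
qed

lemma GL_inverse:
  assumes "A \<in> GL n"
  obtains B where "B \<in> carrier_mat n n" "B * A = 1\<^sub>m n"
proof -
  have A: "A \<in> carrier_mat n n" "det A \<noteq> 0" using assms by (simp_all add: GL_iff_det)
  then show ?thesis
    using det_non_zero_imp_unit[OF A, of "()"] that by (auto simp: Units_def ring_mat_def)
qed

lemma act_inj_on:
  assumes "A \<in> GL n"
  shows "inj_on (act A) (poly_ring n)"
proof -
  obtain B where B: "B \<in> carrier_mat n n" "B * A = 1\<^sub>m n" using GL_inverse[OF assms] .
  have "act B (act A f) = f" if "f \<in> poly_ring n" for f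
    using act_mult[OF that B(1)] assms act_one[OF that] B(2) by (simp add: GL_iff_det)
  then show ?thesis by (metis inj_onI)
qed

text \<open>The product stays indexed by \<open>W\<close>, since \<open>h\<close> need not be
  injective on \<open>W\<close>.\<close>

lemma map_poly_root_poly:
  assumes "comm_ring_hom h"
  shows "map_poly h (root_poly W) = (\<Prod>u\<in>W. [:- h u, 1:])"
proof -
  interpret h: comm_ring_hom h by fact
  interpret hp: map_poly_comm_ring_hom h by unfold_locales
  show ?thesis by (simp add: root_poly_def hp.hom_prod h.map_poly_pCons_hom h.hom_uminus)
qed

text \<open>An invertible matrix permutes the linear forms, which are the roots of
  \<open>forms_poly m\<close>.\<close>

lemma act_coeff_forms_poly:
  assumes "A \<in> GL m"
  shows "act A (coeff (forms_poly m) i) = coeff (forms_poly m) i"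
proof -
  have A: "A \<in> carrier_mat m m" using assms by (simp add: GL_iff_det)
  have inj: "inj_on (act A) (lin_forms m)"
    using act_inj_on[OF assms] lin_forms_subset inj_on_subset by blast
  have img: "act A ` lin_forms m = lin_forms m"
    by (rule endo_inj_surj[OF finite_lin_forms _ inj]) (use A in \<open>auto simp: lin_forms_def act_lin_form\<close>)
  have "map_poly (act A) (forms_poly m) = (\<Prod>u\<in>lin_forms m. [:- act A u, 1:])"
    by (simp add: forms_poly_def map_poly_root_poly[OF act_hom])
  also have "\<dots> = forms_poly m"
    unfolding forms_poly_def root_poly_def by (subst (2) img[symmetric]) (simp add: prod.reindex[OF inj])
  finally have "coeff (map_poly (act A) (forms_poly m)) i = coeff (forms_poly m) i" by simp
  then show ?thesis by (simp add: coeff_map_poly)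
qed

lemma subring_set_invariants: "subring_set (invariants n G)"
  by unfold_locales
    (auto simp: invariants_def act_hom.hom_minus act_hom.hom_mult
      intro: poly_ring.one_closed poly_ring.diff_closed poly_ring.mult_closed)

lemma const_in_invariants: "const c \<in> invariants n G"
  by (simp add: invariants_def)

lemma coeff_forms_poly_in_invariants: "coeff (forms_poly m) i \<in> invariants m (GL m)"
  by (simp add: invariants_def coeff_forms_poly_in_poly_ring act_coeff_forms_poly)

lemma dickson_in_invariants:
  assumes "i \<le> m"
  shows "dickson m i \<in> invariants m (GL m :: 'p::prime_card mod_ring mat set)"
proof -
  interpret subring_set "invariants m (GL m :: 'p mod_ring mat set)" by (rule subring_set_invariants)
  show ?thesis
    by (simp add: dickson_eq_coeff[OF assms] mult_closed power_closed uminus_closed one_closed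
        coeff_forms_poly_in_invariants)
qed

text \<open>The zero block sends the first \<open>m\<close> variables to linear forms in themselves,
  through the block \<open>A\<close> alone.\<close>

lemma parabolic_memD:
  assumes "M \<in> parabolic m 1"
  shows "M \<in> GL (Suc m)" and "\<exists>A\<in>GL m. \<forall>f\<in>poly_ring m. act M f = act A f"
proof -
  obtain A C B where M: "M = four_block_mat A C (0\<^sub>m 1 m) B" and A: "A \<in> GL m" and B: "B \<in> GL 1"
    and C: "C \<in> carrier_mat m 1"
    using assms by (auto simp: parabolic_def)
  have A': "A \<in> carrier_mat m m" "det A \<noteq> 0" and B': "B \<in> carrier_mat 1 1" "det B \<noteq> 0"
    using A B by (simp_all add: GL_iff_det)
  have "det M = det A * det B"
    unfolding M by (rule det_four_block_mat_lower_left_zero[OF A'(1) C _ B'(1)]) auto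
  then show "M \<in> GL (Suc m)"
    using A' B' four_block_carrier_mat[OF A'(1) B'(1), of C "0\<^sub>m 1 m"] by (simp add: GL_iff_det M)
  have "act M f = act A f" if "f \<in> poly_ring m" for f
  proof (rule hom_eq_on_poly_ring[OF that act_hom act_hom])
    fix k assume k: "k < m"
    have "act M (var k) = lin_form m (\<lambda>i. M $$ (i, k)) + const (M $$ (m, k)) * var m"
      using A' B' by (simp add: act_var M lin_form_Suc)
    also have "M $$ (m, k) = 0" using A' B' k by (simp add: M)
    also have "lin_form m (\<lambda>i. M $$ (i, k)) = act A (var k)"
      unfolding act_var carrier_matD(1)[OF A'(1)] using A' B' k by (simp add: M cong: lin_form_cong)
    finally show "act M (var k) = act A (var k)" by simp
  qed simp
  then show "\<exists>A\<in>GL m. \<forall>f\<in>poly_ring m. act M f = act A f" using A by blast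
qed

text \<open>Supplies the group elements used below: translations of the last variable
  (\<open>A\<close> and \<open>b\<close> trivial) and scalings combined with an element of
  \<open>GL m\<close> (\<open>c = 0\<close>).\<close>

lemma parabolic_intro:
  fixes b :: "'p::prime_card mod_ring"
  assumes A: "A \<in> GL m" and b: "b \<noteq> 0"
  obtains M where "M \<in> parabolic m 1" "\<And>f. f \<in> poly_ring m \<Longrightarrow> act M f = act A f"
    "act M (var m) = lin_form m c + const b * var m"
proof -
  define B where "B = mat 1 1 (\<lambda>_. b)"
  define C where "C = mat m 1 (\<lambda>(i, _). c i)"
  define M where "M = four_block_mat A C (0\<^sub>m 1 m) B"
  have A': "A \<in> carrier_mat m m" using A by (simp add: GL_iff_det)
  have "det B = b"
    using laplace_expansion_column[of B 1 0] by (simp add: B_def cofactor_def mat_delete_def)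
  then have "B \<in> GL 1" using b by (simp add: GL_iff_det B_def)
  then have "M \<in> parabolic m 1"
    unfolding parabolic_def M_def using A by (intro CollectI exI[of _ A] exI[of _ B] exI[of _ C]) (simp add: C_def)
  moreover have "act M f = act A f" if "f \<in> poly_ring m" for f
  proof (rule hom_eq_on_poly_ring[OF that act_hom act_hom])
    fix k assume k: "k < m"
    have "act M (var k) = lin_form m (\<lambda>i. M $$ (i, k)) + const (M $$ (m, k)) * var m"
      using A' by (simp add: act_var M_def B_def lin_form_Suc)
    also have "M $$ (m, k) = 0" using A' k by (simp add: M_def B_def)
    also have "lin_form m (\<lambda>i. M $$ (i, k)) = act A (var k)"
      unfolding act_var carrier_matD(1)[OF A'] using A' k by (simp add: M_def B_def cong: lin_form_cong)
    finally show "act M (var k) = act A (var k)" by simp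
  qed simp
  moreover have "act M (var m) = lin_form m c + const b * var m"
  proof -
    have "act M (var m) = lin_form m (\<lambda>i. M $$ (i, m)) + const (M $$ (m, m)) * var m"
      using A' by (simp add: act_var M_def B_def lin_form_Suc)
    also have "M $$ (m, m) = b" using A' by (simp add: M_def B_def)
    also have "lin_form m (\<lambda>i. M $$ (i, m)) = lin_form m c"
      by (rule lin_form_cong) (use A' in \<open>simp add: M_def B_def C_def\<close>)
    finally show ?thesis .
  qed
  ultimately show ?thesis using that by blast
qed

lemma parabolic_subset_GL: "parabolic m 1 \<subseteq> GL (Suc m)"
  using parabolic_memD(1) by (rule subsetI)

lemma invariants_GL_subset_parabolic: "invariants (Suc m) (GL (Suc m)) \<subseteq> invariants (Suc m) (parabolic m 1)"
  using parabolic_subset_GL[of m] by (auto simp: invariants_def)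

lemma invariants_subset_parabolic: "invariants m (GL m) \<subseteq> invariants (Suc m) (parabolic m 1)"
proof
  fix f :: "'a mpol" assume f: "f \<in> invariants m (GL m)"
  then have fm: "f \<in> poly_ring m" and inv: "A \<in> GL m \<Longrightarrow> act A f = f" for A
    by (simp_all add: invariants_def)
  have "f \<in> poly_ring (Suc m)" using fm poly_ring_mono[of m "Suc m"] by auto
  moreover have "act M f = f" if M: "M \<in> parabolic m 1" for M
    using parabolic_memD(2)[OF M] fm inv by fastforce
  ultimately show "f \<in> invariants (Suc m) (parabolic m 1)" by (simp add: invariants_def)
qed

text \<open>If \<open>r = j mod (p - 1)\<close> were positive, \<open>X^r - 1\<close> would vanish
  at all \<open>p - 1\<close> nonzero residues although its degree is smaller.\<close>

lemma power_eq_1_imp_dvd: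
  assumes "\<And>b :: 'p::prime_card mod_ring. b \<noteq> 0 \<Longrightarrow> b ^ j = 1"
  shows "CARD('p) - 1 dvd j"
proof (rule ccontr)
  let ?q = "CARD('p) - 1"
  assume "\<not> ?q dvd j"
  then have r: "j mod ?q > 0" by (simp add: mod_greater_zero_iff_not_dvd)
  let ?P = "monom 1 (j mod ?q) - 1 :: 'p mod_ring poly"
  have "?q > 0" using CARD_prime_gt_1[where 'p = 'p] by simp
  then have "j mod ?q < ?q" by simp
  have coeff: "coeff ?P (j mod ?q) = 1" using r by (simp add: coeff_1)
  then have "?P \<noteq> 0" by (metis coeff_0 zero_neq_one)
  have "degree ?P \<le> j mod ?q" by (rule degree_diff_le) (simp_all add: degree_monom_le)
  have root: "UNIV - {0} \<subseteq> {b. poly ?P b = 0}"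
  proof
    fix b :: "'p mod_ring" assume b: "b \<in> UNIV - {0}"
    have "b ^ j = (b ^ ?q) ^ (j div ?q) * b ^ (j mod ?q)"
      by (metis mult_div_mod_eq power_add power_mult)
    then have "b ^ (j mod ?q) = 1" using assms[of b] b mod_ring_power_CARD_minus_1[of b] by simp
    then show "b \<in> {b. poly ?P b = 0}" by (simp add: poly_monom)
  qed
  have "?q = card (UNIV - {0 :: 'p mod_ring})" by (simp add: card_Diff_singleton)
  also have "\<dots> \<le> card {b. poly ?P b = 0}" by (rule card_mono[OF _ root]) simp
  also have "\<dots> \<le> degree ?P" by (rule card_poly_roots_bound[OF \<open>?P \<noteq> 0\<close>])
  finally show False using \<open>degree ?P \<le> j mod ?q\<close> \<open>j mod ?q < ?q\<close> by simp
qed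

text \<open>\<open>forms_poly m\<close> has positive degree, so composition with it is injective.
  With the transcendence of \<open>var m\<close>, expansions in powers of
  \<open>poly (forms_poly m) (var m)\<close> are unique.\<close>

lemma forms_poly_var_transcendental:
  assumes "\<And>i. coeff F i \<in> poly_ring m" "\<And>i. coeff G i \<in> poly_ring m"
    "poly F (poly (forms_poly m) (var m)) = poly G (poly (forms_poly m) (var m :: 'p::prime_card mpol))"
  shows "F = G"
proof -
  have "pcompose (F - G) (forms_poly m) = 0"
  proof (rule var_transcendental[of _ m])
    show "coeff (pcompose (F - G) (forms_poly m)) i \<in> poly_ring m" for i
      by (rule poly_ring.coeff_pcompose_closed) (use assms in \<open>auto intro: poly_ring.diff_closed coeff_forms_poly_in_poly_ring\<close>)
  qed (use assms in \<open>simp add: poly_pcompose\<close>)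
  then have "F - G = 0"
    by (rule pcompose_eq_0) (use CARD_prime_gt_1[where 'p = 'p] in \<open>simp add: degree_forms_poly\<close>)
  then show ?thesis by simp
qed

text \<open>Invariance under \<open>y\<^sub>n \<mapsto> y\<^sub>n + u\<close> makes \<open>f\<close> a polynomial in \<open>V = \<Prod>\<^sub>u (y\<^sub>n - u)\<close>; the scalings of
  \<open>y\<^sub>n\<close> leave only powers of \<open>V\<^bsup>p-1\<^esup>\<close>, and \<open>GL(n - 1)\<close> fixes the coefficients.\<close>

lemma parabolic_invariant_expansion:
  fixes f :: "'p::prime_card mpol"
  assumes f: "f \<in> invariants (Suc m) (parabolic m 1)"
  shows "\<exists>G. (\<forall>i. coeff G i \<in> invariants m (GL m)) \<and> f = poly G (poly (forms_poly m) (var m)) \<and>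
    (\<forall>i. coeff G i \<noteq> 0 \<longrightarrow> CARD('p) - 1 dvd i)"
proof -
  let ?V = "poly (forms_poly m) (var m) :: 'p mpol"
  have one: "1\<^sub>m m \<in> GL m" by (simp add: GL_iff_det)
  have inv: "act M f = f" if "M \<in> parabolic m 1" for M using f that by (simp add: invariants_def)
  obtain F where F: "\<And>i. coeff F i \<in> poly_ring m" "f = poly F (var m)"
    using poly_ring_Suc_as_poly[of f m] f by (auto simp: invariants_def)
  \<comment> \<open>A translation of the last variable fixes the coefficients of \<open>F\<close>,
    so uniqueness of expansions in \<open>var m\<close> carries the invariance of \<open>f\<close>
    over to \<open>F\<close>.\<close>
  have "pcompose F [:u, 1:] = F" if u: "u \<in> lin_forms m" for u
  proof -
    obtain c where c: "u = lin_form m c" using u by (auto simp: lin_forms_def)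
    obtain M where M: "M \<in> parabolic m 1" "\<And>f. f \<in> poly_ring m \<Longrightarrow> act M f = act (1\<^sub>m m) f"
      "act M (var m) = lin_form m c + const 1 * var m"
      using parabolic_intro[OF one one_neq_zero, of c] by blast
    have "map_poly (act M) F = F"
      by (rule poly_eqI) (simp add: coeff_map_poly F(1) M(2) act_one)
    then have "poly F (u + var m) = poly F (var m)"
      using inv[OF M(1)] act_hom.poly_map_poly[of M F "var m"] by (simp add: F(2) M(3) c)
    then show ?thesis
      by (intro poly_var_inject[of _ m] poly_ring.coeff_pcompose_closed F(1))
        (use u lin_forms_subset[of m] in \<open>auto simp: poly_pcompose coeff_pCons
          intro: poly_ring.zero_closed poly_ring.one_closed split: nat.splits\<close>)
  qed
  then obtain G where G: "\<forall>i. coeff G i \<in> poly_ring m" "F = pcompose G (forms_poly m)"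
    using translation_invariant_pcompose[OF subring_set_poly_ring finite_lin_forms lin_forms_subset
        zero_in_lin_forms lin_forms_add F(1)] unfolding forms_poly_def by blast
  have fG: "f = poly G ?V" by (simp add: F(2) G(2) poly_pcompose)
  \<comment> \<open>The element with diagonal blocks \<open>A\<close> and \<open>b\<close> sends
    \<open>?V\<close> to \<open>b ?V\<close>; uniqueness of the expansion in \<open>?V\<close>
    allows a comparison coefficient by coefficient.\<close>
  have twist: "const b ^ i * act A (coeff G i) = coeff G i" if A: "A \<in> GL m" and b: "b \<noteq> 0" for A b i
  proof -
    obtain M where M: "M \<in> parabolic m 1" "\<And>f. f \<in> poly_ring m \<Longrightarrow> act M f = act A f"
      "act M (var m) = lin_form m (\<lambda>_. 0) + const b * var m"
      using parabolic_intro[OF A b, of "\<lambda>_. 0"] by blast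
    have "map_poly (act M) (forms_poly m) = forms_poly m"
      by (rule poly_eqI)
        (simp add: coeff_map_poly M(2) coeff_forms_poly_in_poly_ring act_coeff_forms_poly[OF A])
    then have V: "act M ?V = const b * ?V"
      using act_hom.poly_map_poly[of M "forms_poly m" "var m"] M(3)
      by (simp add: forms_poly_eq poly_frobenius_poly_scale)
    let ?G = "pcompose (map_poly (act A) G) [:0, const b:]"
    have "map_poly (act M) G = map_poly (act A) G"
      by (rule poly_eqI) (use G(1) M(2) in \<open>simp add: coeff_map_poly\<close>)
    then have "poly ?G ?V = poly G ?V"
      using act_hom.poly_map_poly[of M G ?V] inv[OF M(1)] by (simp add: V fG poly_pcompose mult.commute)
    moreover have "act A g \<in> poly_ring m" if "g \<in> poly_ring m" for g
      using that A unfolding act_def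
      by (intro substitute_in_poly_ring) (auto simp: GL_iff_det lin_form_def[symmetric] lin_form_in_poly_ring)
    ultimately have "?G = G"
      by (intro forms_poly_var_transcendental[of _ m] poly_ring.coeff_pcompose_closed)
        (use G(1) in \<open>auto simp: coeff_map_poly coeff_pCons poly_ring.zero_closed split: nat.splits\<close>)
    then have "coeff ?G i = coeff G i" by simp
    then show ?thesis by (simp add: coeff_pcompose_linear coeff_map_poly)
  qed
  show ?thesis
  proof (intro exI[of _ G] conjI allI impI)
    \<comment> \<open>In \<open>twist\<close>, \<open>b = 1\<close> isolates the action of
      \<open>A\<close>; for the divisibility below, \<open>A = 1\<close> isolates the
      scaling.\<close>
    show "coeff G i \<in> invariants m (GL m)" for i
      using twist[of _ 1 i] G(1) by (simp add: invariants_def)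
    show "f = poly G ?V" by (rule fG)
    show "CARD('p) - 1 dvd i" if "coeff G i \<noteq> 0" for i
    proof (rule power_eq_1_imp_dvd)
      fix b :: "'p mod_ring" assume "b \<noteq> 0"
      have "const (b ^ i) * coeff G i = 1 * coeff G i"
        using twist[OF one \<open>b \<noteq> 0\<close>, of i] G(1) by (simp add: const_hom.hom_power act_one)
      then have "const (b ^ i - 1) = 0" using that by (simp add: const_hom.hom_minus)
      then show "b ^ i = 1" by simp
    qed
  qed
qed

subsection \<open>Spanning\<close>

lemma lin_spanI:
  "finite T \<Longrightarrow> T \<subseteq> B \<Longrightarrow> c ` T \<subseteq> D \<Longrightarrow> f = (\<Sum>b\<in>T. c b * b) \<Longrightarrow> f \<in> lin_span D B"
  unfolding lin_span_def by blast

lemma (in subring_set) lin_span_zero: "0 \<in> lin_span S B"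
  by (rule lin_spanI[of "{}"]) simp_all

lemma (in subring_set) lin_span_base:
  assumes "b \<in> B"
  shows "b \<in> lin_span S B"
  by (rule lin_spanI[of "{b}" _ "\<lambda>_. 1"]) (use assms one_closed in auto)

lemma (in subring_set) lin_span_smult:
  assumes "d \<in> S" "f \<in> lin_span S B"
  shows "d * f \<in> lin_span S B"
proof -
  obtain T c where "finite T" "T \<subseteq> B" "c ` T \<subseteq> S" "f = (\<Sum>b\<in>T. c b * b)"
    using assms(2) by (auto simp: lin_span_def)
  then show ?thesis
    by (intro lin_spanI[of T _ "\<lambda>b. d * c b"])
      (use assms(1) in \<open>auto simp: sum_distrib_left mult.assoc intro: mult_closed\<close>)
qed

lemma (in subring_set) lin_span_add:
  assumes "f \<in> lin_span S B" "g \<in> lin_span S B"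
  shows "f + g \<in> lin_span S B"
proof -
  obtain T c where T: "finite T" "T \<subseteq> B" "c ` T \<subseteq> S" "f = (\<Sum>b\<in>T. c b * b)"
    using assms(1) by (auto simp: lin_span_def)
  obtain U d where U: "finite U" "U \<subseteq> B" "d ` U \<subseteq> S" "g = (\<Sum>b\<in>U. d b * b)"
    using assms(2) by (auto simp: lin_span_def)
  let ?e = "\<lambda>b. (if b \<in> T then c b else 0) + (if b \<in> U then d b else 0)"
  have "f = (\<Sum>b\<in>T \<union> U. (if b \<in> T then c b else 0) * b)"
    unfolding T(4) by (rule sum.mono_neutral_cong_left) (use T U in auto)
  moreover have "g = (\<Sum>b\<in>T \<union> U. (if b \<in> U then d b else 0) * b)"
    unfolding U(4) by (rule sum.mono_neutral_cong_left) (use T U in auto)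
  ultimately have "f + g = (\<Sum>b\<in>T \<union> U. ?e b * b)" by (simp add: sum.distrib distrib_right)
  moreover have "?e ` (T \<union> U) \<subseteq> S"
  proof (rule image_subsetI, rule add_closed)
    show "(if b \<in> T then c b else 0) \<in> S" "(if b \<in> U then d b else 0) \<in> S" for b
      using T(3) U(3) zero_closed by auto
  qed
  ultimately show ?thesis using T(1,2) U(1,2) by (intro lin_spanI[of "T \<union> U" _ ?e]) simp_all
qed

lemma (in subring_set) lin_span_sum:
  "(\<And>i. i \<in> I \<Longrightarrow> f i \<in> lin_span S B) \<Longrightarrow> sum f I \<in> lin_span S B"
  by (induction I rule: infinite_finite_induct) (auto intro: lin_span_zero lin_span_add)

lemma lin_span_mono: "D \<subseteq> D' \<Longrightarrow> lin_span D B \<subseteq> lin_span D' B"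
  unfolding lin_span_def by blast

text \<open>Kept apart from \<open>invariants n (GL n)\<close> until \<open>dickson_theorem\<close>
  identifies the two.\<close>

inductive_set dickson_algebra :: "nat \<Rightarrow> 'p::prime_card mpol set" for n where
  const: "const c \<in> dickson_algebra n"
| dickson: "i < n \<Longrightarrow> dickson n i \<in> dickson_algebra n"
| add: "f \<in> dickson_algebra n \<Longrightarrow> g \<in> dickson_algebra n \<Longrightarrow> f + g \<in> dickson_algebra n"
| mult: "f \<in> dickson_algebra n \<Longrightarrow> g \<in> dickson_algebra n \<Longrightarrow> f * g \<in> dickson_algebra n"

lemma subring_set_dickson_algebra: "subring_set (dickson_algebra n)"
proof
  show "1 \<in> dickson_algebra n" using dickson_algebra.const[of 1] by simp
  fix f g :: "'a mpol" assume "f \<in> dickson_algebra n" "g \<in> dickson_algebra n"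
  then have "f + const (-1) * g \<in> dickson_algebra n" by (intro dickson_algebra.intros)
  then show "f - g \<in> dickson_algebra n" by (simp add: const_hom.hom_uminus)
qed (rule dickson_algebra.mult)

lemma dickson_algebra_subset: "dickson_algebra n \<subseteq> invariants n (GL n)"
proof
  fix f :: "'a mpol" assume "f \<in> dickson_algebra n"
  then show "f \<in> invariants n (GL n)"
  proof induction
    case (add f g)
    then show ?case by (intro subring_set.add_closed[OF subring_set_invariants])
  next
    case (mult f g)
    then show ?case by (intro subring_set.mult_closed[OF subring_set_invariants])
  qed (simp_all add: const_in_invariants dickson_in_invariants)
qed

text \<open>One formula for all families of the theorem: \<open>s = 0\<close> is the first,
  \<open>s = t\<close> the one with index \<open>t\<close> in the union, so the exponent
  \<open>p\<close> sits at index \<open>s - 1\<close>.\<close>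

definition basis_elem :: "nat \<Rightarrow> nat \<Rightarrow> (nat \<Rightarrow> nat) \<Rightarrow> 'p::prime_card mpol" where
  "basis_elem m s e = (if s = 0 then 1 else dickson m (s - 1) ^ CARD('p)) * (\<Prod>i\<in>{s..<m}. dickson m i ^ e i)"

definition parabolic_basis :: "nat \<Rightarrow> 'p::prime_card mpol set" where
  "parabolic_basis m = {basis_elem m s e | s e. s \<le> m \<and> (\<forall>i\<in>{s..<m}. e i < CARD('p))}"

lemma prod_mset_sum_replicate:
  fixes x :: "nat \<Rightarrow> 'a::comm_monoid_mult"
  shows "finite I \<Longrightarrow> prod_mset (image_mset x (\<Sum>i\<in>I. replicate_mset (e i) i)) = (\<Prod>i\<in>I. x i ^ e i)"
  by (induction I rule: finite_induct) auto

lemma basis_elem_monomial: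
  assumes "s \<le> m"
  obtains M where "set_mset M \<subseteq> {..<m}" "basis_elem m s e = (\<Prod>i\<in>#M. dickson m i :: 'p::prime_card mpol)"
proof
  let ?M = "(if s = 0 then {#} else replicate_mset CARD('p) (s - 1)) + (\<Sum>i\<in>{s..<m}. replicate_mset (e i) i)"
  show "basis_elem m s e = (\<Prod>i\<in>#?M. dickson m i :: 'p mpol)"
    by (simp add: basis_elem_def prod_mset_sum_replicate)
  show "set_mset ?M \<subseteq> {..<m}"
    using assms by (auto simp: set_mset_sum split: if_splits)
qed

lemma prod_mset_eq_prod_power:
  fixes x :: "nat \<Rightarrow> 'a::comm_monoid_mult"
  assumes "set_mset M \<subseteq> I" "finite I"
  shows "prod_mset (image_mset x M) = (\<Prod>i\<in>I. x i ^ count M i)"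
  unfolding image_prod_mset_multiplicity
  by (rule prod.mono_neutral_left) (use assms in \<open>auto simp: not_in_iff\<close>)

text \<open>The spanning argument is run over two coefficient rings: over
  \<open>dickson_algebra (Suc m)\<close> inside the induction for \<open>dickson_theorem\<close>,
  and over all \<open>GL (Suc m)\<close>-invariants for the final result.\<close>

locale dickson_coefficients = subring_set D for D :: "'p::prime_card mpol set" +
  fixes m :: nat
  assumes const_mem: "const c \<in> D" and dickson_mem: "i \<le> m \<Longrightarrow> dickson (Suc m) i \<in> D"
begin

abbreviation span :: "'p mpol set" where
  "span \<equiv> lin_span D (parabolic_basis m)"

lemma monomial_in_span:
  assumes "set_mset M \<subseteq> {..<m}"
  shows "(\<Prod>i\<in>#M. dickson m i) \<in> span"
\<comment> \<open>The recursion for the Dickson invariants supplies the relations, and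
  \<open>dickson m m = 1\<close> the boundary value.\<close>
proof (rule monomial_in_submodule[where D = D and m = m and v = "top_form m" and p = "CARD('p)" and x = "dickson m"])
  show "top_form m * dickson m 0 \<in> D" using dickson_mem[of 0] by (simp add: dickson_Suc_0)
  show "dickson m i ^ CARD('p) + top_form m * dickson m (Suc i) \<in> D" if "i < m" for i
    using dickson_mem[of "Suc i"] that by (simp add: dickson_Suc_Suc)
  show "(\<Prod>i\<in>#M. dickson m i) \<in> span" if M: "set_mset M \<subseteq> {..<m}" and lt: "\<And>i. count M i < CARD('p)" for M
  proof (rule lin_span_base)
    have "(\<Prod>i\<in>#M. dickson m i) = (basis_elem m 0 (count M) :: 'p mpol)"
      using prod_mset_eq_prod_power[OF M] by (simp add: basis_elem_def atLeast0LessThan)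
    then show "(\<Prod>i\<in>#M. dickson m i) \<in> (parabolic_basis m :: 'p mpol set)"
      unfolding parabolic_basis_def using lt by blast
  qed
  show "(\<Prod>i\<in>#M. dickson m i) \<in> span" if M: "set_mset M \<subseteq> {t..<m}" and t: "t < m" "count M t = CARD('p)"
    and lt: "\<And>i. i \<noteq> t \<Longrightarrow> count M i < CARD('p)" for M t
  proof (rule lin_span_base)
    \<comment> \<open>Index \<open>t\<close> carries the exponent \<open>p\<close>, so the monomial
      belongs to family \<open>Suc t\<close>.\<close>
    have "(\<Prod>i\<in>#M. dickson m i) = (basis_elem m (Suc t) (count M) :: 'p mpol)"
      using prod_mset_eq_prod_power[OF M, of "dickson m"] t by (simp add: basis_elem_def prod.atLeast_Suc_lessThan)
    moreover have "Suc t \<le> m \<and> (\<forall>i\<in>{Suc t..<m}. count M i < CARD('p))" using t lt by auto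
    ultimately show "(\<Prod>i\<in>#M. dickson m i) \<in> (parabolic_basis m :: 'p mpol set)"
      unfolding parabolic_basis_def by blast
  qed
qed (use assms CARD_prime_gt_1[where 'p = 'p] in
    \<open>auto intro: lin_span_add lin_span_smult uminus_closed lin_span_zero\<close>)

text \<open>These are closed under sums and products, so membership can be tested on generators;
  since \<open>1 \<in> span\<close>, every multiplier lies in \<open>span\<close>.\<close>

definition multipliers :: "'p mpol set" where
  "multipliers = {r. \<forall>f\<in>span. r * f \<in> span}"

lemma multipliers_add: "r \<in> multipliers \<Longrightarrow> s \<in> multipliers \<Longrightarrow> r + s \<in> multipliers"
  and multipliers_mult: "r \<in> multipliers \<Longrightarrow> s \<in> multipliers \<Longrightarrow> r * s \<in> multipliers"
  by (auto simp: multipliers_def distrib_right mult.assoc intro: lin_span_add)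

lemma multipliers_D: "D \<subseteq> multipliers"
  by (auto simp: multipliers_def intro: lin_span_smult)

lemma multipliers_power: "r \<in> multipliers \<Longrightarrow> r ^ k \<in> multipliers"
  by (induction k) (use multipliers_D one_closed multipliers_mult in auto)

lemma dickson_multiplier:
  assumes i: "i < m"
  shows "dickson m i \<in> multipliers"
  unfolding multipliers_def
proof (intro CollectI ballI)
  fix f assume "f \<in> span"
  then obtain T c where T: "T \<subseteq> parabolic_basis m" "c ` T \<subseteq> D" "f = (\<Sum>b\<in>T. c b * b)"
    by (auto simp: lin_span_def)
  have "dickson m i * b \<in> span" if b: "b \<in> T" for b
  proof -
    obtain s e where se: "s \<le> m" "b = basis_elem m s e" using T(1) b by (auto simp: parabolic_basis_def)
    obtain M where M: "set_mset M \<subseteq> {..<m}" "b = (\<Prod>i\<in>#M. dickson m i)"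
      using basis_elem_monomial[OF se(1), of e] se(2) by metis
    then show ?thesis using monomial_in_span[of "add_mset i M"] i by simp
  qed
  then have "c b * (dickson m i * b) \<in> span" if "b \<in> T" for b
    using T(2) that by (auto intro: lin_span_smult)
  then have "(\<Sum>b\<in>T. c b * (dickson m i * b)) \<in> span" by (rule lin_span_sum)
  also have "(\<Sum>b\<in>T. c b * (dickson m i * b)) = dickson m i * f"
    by (simp add: T(3) sum_distrib_left mult.left_commute)
  finally show "dickson m i * f \<in> span" .
qed

text \<open>As \<open>dickson m m = 1\<close>, the last recursion expresses \<open>v\<close> as the
  difference of a coefficient in \<open>D\<close> and the \<open>p\<close>-th power of
  \<open>dickson m (m - 1)\<close>. For \<open>m = 0\<close>, \<open>v\<close> itself is
  \<open>dickson 1 0\<close>.\<close>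

lemma top_form_multiplier: "top_form m \<in> multipliers"
proof (cases m)
  case 0
  then have "top_form m = (dickson (Suc m) 0 :: 'p mpol)" by (simp add: dickson_Suc_0)
  then show ?thesis using dickson_mem[of 0] multipliers_D by auto
next
  case (Suc k)
  then have "top_form m = dickson (Suc m) m + const (- 1) * (dickson m k :: 'p mpol) ^ CARD('p)"
    using dickson_Suc_Suc[of k m, where 'p = 'p] by (simp add: const_hom.hom_uminus algebra_simps)
  moreover have "dickson (Suc m) m \<in> multipliers" "const (- 1) \<in> multipliers"
    using dickson_mem[of m] const_mem multipliers_D by auto
  moreover have "dickson m k \<in> multipliers" using dickson_multiplier[of k] Suc by simp
  ultimately show ?thesis by (simp only: multipliers_add multipliers_mult multipliers_power)
qed

text \<open>The expansion in powers of \<open>v\<close> has multipliers as coefficients, by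
  Dickson's theorem for \<open>m\<close>. That theorem is an assumption here because it is the
  induction hypothesis in \<open>dickson_theorem\<close>.\<close>

lemma parabolic_invariants_subset_span:
  assumes dickson_thm: "invariants m (GL m) \<subseteq> (dickson_algebra m :: 'p mpol set)"
  shows "invariants (Suc m) (parabolic m 1) \<subseteq> span"
proof
  fix f :: "'p mpol" assume "f \<in> invariants (Suc m) (parabolic m 1)"
  then obtain G where G: "\<forall>i. coeff G i \<in> invariants m (GL m)" "f = poly G (poly (forms_poly m) (var m))"
    "\<forall>i. coeff G i \<noteq> 0 \<longrightarrow> CARD('p) - 1 dvd i"
    using parabolic_invariant_expansion by blast
  have alg: "dickson_algebra m \<subseteq> multipliers"
  proof
    fix r :: "'p mpol" assume "r \<in> dickson_algebra m"
    then show "r \<in> multipliers"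
      by induction (use const_mem multipliers_D dickson_multiplier multipliers_add multipliers_mult in auto)
  qed
  have zero: "0 \<in> multipliers" using multipliers_D zero_closed by auto
  have "coeff G i * poly (forms_poly m) (var m) ^ i \<in> multipliers" for i
  proof (cases "coeff G i = 0")
    case False
    then obtain k where k: "i = (CARD('p) - 1) * k" using G(3) by (auto elim: dvdE)
    have "coeff G i \<in> multipliers" using G(1) dickson_thm alg by blast
    moreover have "poly (forms_poly m) (var m) ^ i = (top_form m ^ k :: 'p mpol)"
      by (simp add: top_form_def power_mult k)
    ultimately show ?thesis using top_form_multiplier by (simp add: multipliers_mult multipliers_power)
  qed (simp add: zero)
  moreover have "sum h I \<in> multipliers" if "\<And>i. h i \<in> multipliers" for h :: "nat \<Rightarrow> 'p mpol" and I
    by (induction I rule: infinite_finite_induct) (auto simp: that zero multipliers_add)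
  ultimately have "f \<in> multipliers" unfolding G(2) poly_altdef by simp
  moreover have "1 \<in> span" using monomial_in_span[of "{#}"] by simp
  ultimately have "f * 1 \<in> span" unfolding multipliers_def by blast
  then show "f \<in> span" by simp
qed

end

subsection \<open>Linear independence\<close>

definition hyper_coeffs :: "nat \<Rightarrow> nat \<Rightarrow> (nat \<Rightarrow> 'a::comm_ring_1) \<Rightarrow> nat \<Rightarrow> nat \<Rightarrow> 'a" where
  "hyper_coeffs m s c k i =
    (if k < s then of_bool (i = k)
     else if k < m then of_bool (i = Suc k) - c k * of_bool (i = s)
     else of_bool (i = s))"

text \<open>Over a field, each hyperplane is the kernel of one form whose first nonzero coefficient
  is 1. Here that coefficient stands at \<open>s\<close>, and \<open>c i\<close> is the one at
  \<open>i + 1\<close>, so \<open>(s, c)\<close> matches the family and the exponents in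
  \<open>basis_elem\<close>.\<close>

definition hyper_form :: "nat \<Rightarrow> nat \<Rightarrow> (nat \<Rightarrow> 'a::comm_ring_1) \<Rightarrow> (nat \<Rightarrow> 'a) \<Rightarrow> 'a" where
  "hyper_form m s c a = a s + (\<Sum>i\<in>{s..<m}. c i * a (Suc i))"

text \<open>The first \<open>m\<close> columns of \<open>hyper_mat m s c\<close> form a basis of the hyperplane \<open>hyper_form m s c = 0\<close>.\<close>

definition hyper_mat :: "nat \<Rightarrow> nat \<Rightarrow> (nat \<Rightarrow> 'a::comm_ring_1) \<Rightarrow> 'a mat" where
  "hyper_mat m s c = mat (Suc m) (Suc m) (\<lambda>(i, k). hyper_coeffs m s c k i)"

lemma hyper_form_of_bool:
  assumes "k \<le> m"
  shows "hyper_form m s c (\<lambda>i. of_bool (i = k)) = of_bool (s = k) + (if s < k then c (k - 1) else 0)"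
proof (cases k)
  case 0
  then show ?thesis by (simp add: hyper_form_def)
next
  case (Suc k')
  have "(\<Sum>i\<in>{s..<m}. c i * of_bool (Suc i = k)) = (\<Sum>i\<in>{s..<m}. if i = k' then c i else 0)"
    by (rule sum.cong) (auto simp: Suc)
  also have "\<dots> = (if s < k then c (k - 1) else 0)"
    using assms Suc by (subst sum.delta) auto
  finally show ?thesis by (simp add: hyper_form_def)
qed

lemma hyper_form_diff:
  "hyper_form m s c (\<lambda>i. a i - x * b i) = hyper_form m s c a - x * hyper_form m s c b"
  by (simp add: hyper_form_def algebra_simps sum_subtractf sum_distrib_left)

lemma hyper_form_sum:
  "hyper_form m s c (\<lambda>i. \<Sum>l\<in>K. x l * a l i) = (\<Sum>l\<in>K. x l * hyper_form m s c (a l))"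
  by (simp add: hyper_form_def sum_distrib_left distrib_left sum.distrib sum.swap[of _ K] mult.left_commute)

lemma hyper_form_cong:
  "s \<le> m \<Longrightarrow> (\<And>i. i \<le> m \<Longrightarrow> a i = b i) \<Longrightarrow> hyper_form m s c a = hyper_form m s c b"
  by (simp add: hyper_form_def)

lemma hyper_form_hyper_coeffs:
  assumes "s \<le> k" "k < m"
  shows "hyper_form m s' c' (hyper_coeffs m s c k) =
    hyper_form m s' c' (\<lambda>i. of_bool (i = Suc k)) - c k * hyper_form m s' c' (\<lambda>i. of_bool (i = s))"
proof -
  have "hyper_coeffs m s c k = (\<lambda>i. of_bool (i = Suc k) - c k * of_bool (i = s))"
    using assms by (auto simp: hyper_coeffs_def)
  then show ?thesis by (simp only: hyper_form_diff)
qed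

lemma hyper_form_hyper_coeffs_self:
  assumes "k < m" "s \<le> m"
  shows "hyper_form m s c (hyper_coeffs m s c k) = 0"
proof (cases "k < s")
  case True
  then have "hyper_coeffs m s c k = (\<lambda>i. of_bool (i = k))" by (auto simp: hyper_coeffs_def)
  then show ?thesis using True assms by (simp add: hyper_form_of_bool)
next
  case False
  then show ?thesis using assms by (simp add: hyper_form_hyper_coeffs hyper_form_of_bool)
qed

lemma hyper_mat_in_GL:
  assumes "s \<le> m"
  shows "hyper_mat m s c \<in> GL (Suc m)"
proof -
  let ?A = "hyper_mat m s c"
  have A: "?A \<in> carrier_mat (Suc m) (Suc m)" by (simp add: hyper_mat_def)
  have "det ?A \<noteq> 0"
  proof
    assume "det ?A = 0"
    then obtain v where v: "v \<in> carrier_vec (Suc m)" "v \<noteq> 0\<^sub>v (Suc m)" "?A *\<^sub>v v = 0\<^sub>v (Suc m)"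
      using det_0_iff_vec_prod_zero[OF A] by blast
    have row: "(\<Sum>k<Suc m. hyper_coeffs m s c k i * v $ k) = 0" if "i < Suc m" for i
    proof -
      have "(?A *\<^sub>v v) $ i = 0" using v(3) that by simp
      then show ?thesis using v(1) that by (simp add: hyper_mat_def scalar_prod_def atLeast0LessThan)
    qed
    have low: "v $ k = 0" if k: "k < m" for k
    proof -
      \<comment> \<open>The row whose only nonzero entry lies in column \<open>k\<close>; every row
        except \<open>s\<close> arises in this way.\<close>
      define i where "i = (if k < s then k else Suc k)"
      have "(\<Sum>l<Suc m. hyper_coeffs m s c l i * v $ l) = (\<Sum>l<Suc m. if l = k then v $ l else 0)"
        by (rule sum.cong) (use k assms in \<open>auto simp: hyper_coeffs_def i_def\<close>)
      also have "\<dots> = v $ k" using k by simp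
      finally show ?thesis using row[of i] k by (simp add: i_def)
    qed
    have "(\<Sum>l<Suc m. hyper_coeffs m s c l s * v $ l) = v $ m"
      using assms low by (simp add: hyper_coeffs_def)
    then have "v $ m = 0" using row[of s] assms by simp
    then have "v = 0\<^sub>v (Suc m)" using v(1) low by (intro eq_vecI) (auto simp: less_Suc_eq)
    then show False using v(2) by simp
  qed
  then show ?thesis using A by (simp add: GL_iff_det)
qed

lemma act_hyper_mat_lin_form:
  "act (hyper_mat m s c) (lin_form m a) = lin_form (Suc m) (\<lambda>i. \<Sum>l<m. a l * hyper_coeffs m s c l i)"
  unfolding act_lin_form hyper_mat_def dim_row_mat by (rule lin_form_cong) simp

text \<open>The invariants include the coefficients of \<open>forms_poly m\<close>, so the two
  images of this polynomial agree and have the same roots. These roots are the linear forms whose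
  coefficient vectors make up the hyperplane, so the first hyperplane lies in the second; evaluating
  the second form on a basis of the first recovers \<open>s\<close> and \<open>c\<close>.\<close>

lemma act_hyper_mat_separates:
  fixes c c' :: "nat \<Rightarrow> 'p::prime_card mod_ring"
  assumes s: "s \<le> m" "s' \<le> m"
    and eq: "\<And>f :: 'p mpol. f \<in> invariants m (GL m) \<Longrightarrow> act (hyper_mat m s c) f = act (hyper_mat m s' c') f"
  shows "s' \<le> s" and "s = s' \<Longrightarrow> i \<in> {s..<m} \<Longrightarrow> c i = c' i"
proof -
  let ?\<sigma> = "act (hyper_mat m s c) :: 'p mpol \<Rightarrow> 'p mpol" and ?\<sigma>' = "act (hyper_mat m s' c') :: 'p mpol \<Rightarrow> 'p mpol"
  have "map_poly ?\<sigma> (forms_poly m) = map_poly ?\<sigma>' (forms_poly m)"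
    by (rule poly_eqI) (simp add: coeff_map_poly eq coeff_forms_poly_in_invariants)
  then have prods: "(\<Prod>u\<in>lin_forms m. [:- ?\<sigma> u, 1:]) = (\<Prod>u\<in>lin_forms m. [:- ?\<sigma>' u, 1:])"
    by (simp add: forms_poly_def map_poly_root_poly act_hom)
  have vanish: "hyper_form m s' c' (hyper_coeffs m s c k) = 0" if k: "k < m" for k
  proof -
    let ?u = "lin_form m (\<lambda>i. if i = k then 1 else 0) :: 'p mpol"
    have u: "?u \<in> lin_forms m" by (simp add: lin_forms_def)
    have "poly (\<Prod>u\<in>lin_forms m. [:- ?\<sigma> u, 1:]) (?\<sigma> ?u) = 0"
      using u by (auto simp: poly_prod)
    then have "poly (\<Prod>u\<in>lin_forms m. [:- ?\<sigma>' u, 1:]) (?\<sigma> ?u) = 0" by (simp only: prods)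
    then have "\<exists>u\<in>lin_forms m. ?\<sigma> ?u = ?\<sigma>' u" by (simp add: poly_prod)
    then obtain a where "?\<sigma> ?u = ?\<sigma>' (lin_form m a)" by (auto simp: lin_forms_def)
    then have eq': "lin_form (Suc m) (hyper_coeffs m s c k) =
        lin_form (Suc m) (\<lambda>i. \<Sum>l<m. a l * hyper_coeffs m s' c' l i)"
      using k by (simp add: act_hyper_mat_lin_form if_distrib[of "\<lambda>x. x * _"] cong: if_cong)
    have "hyper_coeffs m s c k i = (\<Sum>l<m. a l * hyper_coeffs m s' c' l i)" if "i \<le> m" for i
      using arg_cong[OF eq', of "\<lambda>f. Poly_Mapping.lookup f (Poly_Mapping.single i 1)"] that
      by (simp add: lookup_lin_form del: One_nat_def)
    then have "hyper_form m s' c' (hyper_coeffs m s c k) =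
        hyper_form m s' c' (\<lambda>i. \<Sum>l<m. a l * hyper_coeffs m s' c' l i)"
      by (intro hyper_form_cong s)
    also have "\<dots> = 0"
      using s by (simp add: hyper_form_sum hyper_form_hyper_coeffs_self)
    finally show ?thesis .
  qed
  show "s' \<le> s"
  proof (rule ccontr)
    assume "\<not> s' \<le> s"
    \<comment> \<open>If \<open>s < s'\<close>, column \<open>s' - 1\<close> is the unit vector at
      \<open>s'\<close> minus a multiple of the one at \<open>s\<close>; the second form has the
      value 1 there.\<close>
    then have "s \<le> s' - 1" "s' - 1 < m" "Suc (s' - 1) = s'" "s < s'" using s by auto
    then show False
      using vanish[of "s' - 1"] hyper_form_hyper_coeffs[of s "s' - 1" m s' c' c] s
      by (simp add: hyper_form_of_bool)
  qed
  \<comment> \<open>Column \<open>i\<close> has the value \<open>c' i - c i\<close> under the second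
    form.\<close>
  show "c i = c' i" if "s = s'" "i \<in> {s..<m}"
    using vanish[of i] hyper_form_hyper_coeffs[of s i m s' c' c] that
    by (simp add: hyper_form_of_bool)
qed

section \<open>Indexing the basis by hyperplanes\<close>

definition digit :: "'p::prime_card mod_ring \<Rightarrow> nat" where
  "digit a = nat (to_int_mod_ring a)"

lemma digit_bij: "bij_betw (digit :: 'p::prime_card mod_ring \<Rightarrow> nat) UNIV {..<CARD('p)}"
proof -
  have range: "to_int_mod_ring (a :: 'p mod_ring) \<in> {0..<int CARD('p)}" for a
    using range_to_int_mod_ring[where 'a = 'p] by blast
  have "inj (digit :: 'p mod_ring \<Rightarrow> nat)"
    by (rule inj_on_inverseI[where g = "\<lambda>k. of_int_mod_ring (int k)"])
      (use range in \<open>simp add: digit_def\<close>)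
  moreover have "range (digit :: 'p mod_ring \<Rightarrow> nat) \<subseteq> {..<CARD('p)}"
    using range by (auto simp: digit_def nat_less_iff)
  ultimately show ?thesis
    by (simp add: bij_betw_def card_image card_subset_eq)
qed

definition basis_index :: "nat \<Rightarrow> (nat \<times> (nat \<Rightarrow> 'p::prime_card mod_ring)) set" where
  "basis_index m = (SIGMA s:{..m}. {s..<m} \<rightarrow>\<^sub>E UNIV)"

text \<open>Exponents below \<open>p\<close> are read as field elements through
  \<open>digit\<close>, which gives every basis element at least one hyperplane.\<close>

lemma parabolic_basis_subset_image:
  "(parabolic_basis m :: 'p::prime_card mpol set) \<subseteq>
    (\<lambda>(s, c). basis_elem m s (\<lambda>i. digit (c i :: 'p mod_ring))) ` basis_index m"
proof
  fix b :: "'p mpol" assume "b \<in> parabolic_basis m"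
  then obtain s e where se: "s \<le> m" "\<forall>i\<in>{s..<m}. e i < CARD('p)" "b = basis_elem m s e"
    by (auto simp: parabolic_basis_def)
  have "\<exists>a :: 'p mod_ring. digit a = e i" if "i \<in> {s..<m}" for i
    using se(2) that digit_bij[where 'p = 'p] by (metis bij_betw_def imageE lessThan_iff)
  then obtain c :: "nat \<Rightarrow> 'p mod_ring" where c: "\<And>i. i \<in> {s..<m} \<Longrightarrow> digit (c i) = e i" by metis
  have "b = basis_elem m s (\<lambda>i. digit (restrict c {s..<m} i))"
    unfolding se(3) basis_elem_def using c by (auto intro!: prod.cong)
  moreover have "(s, restrict c {s..<m}) \<in> basis_index m"
    using se(1) by (simp add: basis_index_def)
  ultimately show "b \<in> (\<lambda>(s, c). basis_elem m s (\<lambda>i. digit (c i :: 'p mod_ring))) ` basis_index m"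
    by (force intro: image_eqI[rotated])
qed

lemma finite_parabolic_basis: "finite (parabolic_basis m :: 'p::prime_card mpol set)"
proof (rule finite_subset[OF parabolic_basis_subset_image])
  show "finite ((\<lambda>(s, c). basis_elem m s (\<lambda>i. digit (c i :: 'p mod_ring)) :: 'p mpol) ` basis_index m)"
    by (simp add: basis_index_def finite_PiE)
qed

text \<open>Each basis element determines a hyperplane, and the stabilisers of distinct hyperplanes are distinct
  conjugates of the parabolic subgroup.  This yields as many characters of the ring of parabolic
  invariants over the ring of Dickson invariants as there are basis elements.\<close>

lemma lin_indep_parabolic_basis:
  assumes span: "invariants (Suc m) (parabolic m 1) \<subseteq>
    lin_span (invariants (Suc m) (GL (Suc m))) (parabolic_basis m :: 'p::prime_card mpol set)"
  shows "lin_indep (invariants (Suc m) (GL (Suc m))) (parabolic_basis m :: 'p mpol set)"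
proof -
  let ?B = "parabolic_basis m :: 'p mpol set"
  let ?\<beta> = "\<lambda>(s, c). basis_elem m s (\<lambda>i. digit (c i :: 'p mod_ring)) :: 'p mpol"
  have "\<forall>b\<in>?B. \<exists>j. j \<in> basis_index m \<and> ?\<beta> j = b"
    using parabolic_basis_subset_image[of m, where 'p = 'p] by fast
  \<comment> \<open>One index is chosen for each basis element. Since \<open>?\<beta>\<close>
    recovers the element from its index, distinct elements get distinct indices.\<close>
  then obtain j where j: "\<forall>b\<in>?B. j b \<in> basis_index m \<and> ?\<beta> (j b) = b"
    by (rule bchoice[THEN exE])
  define A where "A b = hyper_mat m (fst (j b)) (snd (j b))" for b
  have s: "fst (j b) \<le> m" "snd (j b) \<in> {fst (j b)..<m} \<rightarrow>\<^sub>E UNIV" if "b \<in> ?B" for b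
    using j[rule_format, OF that] by (cases "j b"; auto simp: basis_index_def)+
  interpret M: subring_set "invariants (Suc m) (parabolic m 1) :: 'p mpol set"
    by (rule subring_set_invariants)
  interpret D: subring_set "invariants (Suc m) (GL (Suc m)) :: 'p mpol set"
    by (rule subring_set_invariants)
  show ?thesis
  proof (rule lin_indep_of_characters[OF finite_parabolic_basis span D.zero_closed M.one_closed M.mult_closed])
    show "comm_ring_hom (act (A b) :: 'p mpol \<Rightarrow> 'p mpol)" for b by (rule act_hom)
    show "act (A b) d = d" if "b \<in> ?B" "d \<in> invariants (Suc m) (GL (Suc m))" for b d
      using that hyper_mat_in_GL[OF s(1)[OF that(1)], of "snd (j b)"] by (simp add: A_def invariants_def)
    show "\<exists>f\<in>invariants (Suc m) (parabolic m 1). act (A b) f \<noteq> act (A b') f"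
      if b: "b \<in> ?B" "b' \<in> ?B" and ne: "b \<noteq> b'" for b b'
    proof (rule ccontr)
      assume "\<not> ?thesis"
      \<comment> \<open>The subring \<open>invariants m (GL m)\<close> already tells the hyperplanes
        apart.\<close>
      then have "act (A b) f = act (A b') f" if "f \<in> invariants m (GL m)" for f
        using that invariants_subset_parabolic by blast
      then have eq: "\<And>f. f \<in> invariants m (GL m) \<Longrightarrow>
          act (hyper_mat m (fst (j b)) (snd (j b))) f = act (hyper_mat m (fst (j b')) (snd (j b'))) f"
        by (simp add: A_def)
      have "fst (j b') \<le> fst (j b)" using act_hyper_mat_separates(1)[OF s(1)[OF b(1)] s(1)[OF b(2)] eq] .
      moreover have "fst (j b) \<le> fst (j b')"
        using act_hyper_mat_separates(1)[OF s(1)[OF b(2)] s(1)[OF b(1)] eq[symmetric]] .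
      ultimately have fst: "fst (j b) = fst (j b')" by simp
      have "snd (j b) = snd (j b')"
      proof (rule PiE_ext)
        show "snd (j b) \<in> {fst (j b)..<m} \<rightarrow>\<^sub>E UNIV" using s(2)[OF b(1)] .
        show "snd (j b') \<in> {fst (j b)..<m} \<rightarrow>\<^sub>E UNIV" using s(2)[OF b(2)] fst by simp
        show "snd (j b) i = snd (j b') i" if "i \<in> {fst (j b)..<m}" for i
          using act_hyper_mat_separates(2)[OF s(1)[OF b(1)] s(1)[OF b(2)] eq fst that] .
      qed
      then have "j b = j b'" using fst by (simp add: prod_eq_iff)
      then show False using j b ne by metis
    qed
  qed
qed

section \<open>Dickson's theorem and the free basis\<close>

lemma one_in_parabolic_basis: "1 \<in> (parabolic_basis m :: 'p::prime_card mpol set)"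
proof -
  have "basis_elem m 0 (\<lambda>_. 0) = (1 :: 'p mpol)" by (simp add: basis_elem_def)
  moreover have "0 < CARD('p)" using CARD_prime_gt_1[where 'p = 'p] by simp
  ultimately show ?thesis unfolding parabolic_basis_def by force
qed

text \<open>An invariant \<open>f\<close> of \<open>GL(m + 1)\<close> is a parabolic invariant; comparing its expansion over the subalgebra
  generated by the \<open>d\<^bsub>m+1,i\<^esub>\<close> with the trivial expansion \<open>f \<cdot> 1\<close> shows that \<open>f\<close> lies in that subalgebra.\<close>

theorem dickson_theorem: "invariants m (GL m) = (dickson_algebra m :: 'p::prime_card mpol set)"
proof
  show "(dickson_algebra m :: 'p mpol set) \<subseteq> invariants m (GL m)" by (rule dickson_algebra_subset)
  show "invariants m (GL m) \<subseteq> (dickson_algebra m :: 'p mpol set)"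
  proof (induction m)
    case 0
    show ?case
    proof
      fix f :: "'p mpol" assume "f \<in> invariants 0 (GL 0)"
      then have "f \<in> poly_ring 0" by (simp add: invariants_def)
      then show "f \<in> dickson_algebra 0"
        by (induction rule: poly_ring_induct) (auto intro: dickson_algebra.intros)
    qed
  next
    case (Suc m)
    let ?D = "invariants (Suc m) (GL (Suc m)) :: 'p mpol set"
    interpret dickson_coefficients "dickson_algebra (Suc m) :: 'p mpol set" m
      by (rule dickson_coefficients.intro[OF subring_set_dickson_algebra], unfold_locales)
        (auto intro: dickson_algebra.intros)
    have sp: "invariants (Suc m) (parabolic m 1) \<subseteq> span"
      by (rule parabolic_invariants_subset_span[OF Suc.IH])
    \<comment> \<open>Spanning over the Dickson algebra implies spanning over the larger ring
      \<open>?D\<close>, which gives independence over all of \<open>?D\<close>.\<close>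
    have indep: "lin_indep ?D (parabolic_basis m)"
      by (rule lin_indep_parabolic_basis)
        (use sp lin_span_mono[OF dickson_algebra_subset, of "Suc m" "parabolic_basis m"] in blast)
    show ?case
    proof
      fix f assume f: "f \<in> ?D"
      then have "f \<in> span" using invariants_GL_subset_parabolic sp by blast
      then obtain T c where T: "finite T" "T \<subseteq> parabolic_basis m" "c ` T \<subseteq> dickson_algebra (Suc m)"
        "f = (\<Sum>b\<in>T. c b * b)" by (auto simp: lin_span_def)
      \<comment> \<open>The difference of the expansion of \<open>f\<close> over the algebra and the
        expansion \<open>f * 1\<close>. The element 1 is inserted because it may be missing from
        \<open>T\<close>.\<close>
      let ?c = "\<lambda>b. (if b \<in> T then c b else 0) - (if b = 1 then f else 0)"
      interpret D: subring_set ?D by (rule subring_set_invariants)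
      have "(\<Sum>b\<in>insert 1 T. (if b \<in> T then c b else 0) * b) = f"
        unfolding T(4) by (rule sum.mono_neutral_cong_right) (use T(1) in auto)
      moreover have "(\<Sum>b\<in>insert 1 T. (if b = 1 then f else 0) * b) = (\<Sum>b\<in>insert 1 T. if b = 1 then f else 0)"
        by (rule sum.cong) auto
      ultimately have "(\<Sum>b\<in>insert 1 T. ?c b * b) = 0"
        using T(1) by (simp add: left_diff_distrib sum_subtractf del: sum.insert sum.insert_if)
      moreover have "?c ` insert 1 T \<subseteq> ?D"
      proof (rule image_subsetI, rule D.diff_closed)
        show "(if b \<in> T then c b else 0) \<in> ?D" "(if b = 1 then f else 0) \<in> ?D" for b
          using T(3) f D.zero_closed dickson_algebra_subset[of "Suc m", where 'a = 'p] by auto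
      qed
      moreover have "finite (insert 1 T)" "insert 1 T \<subseteq> parabolic_basis m"
        using T(1,2) one_in_parabolic_basis by auto
      ultimately have "\<forall>b\<in>insert 1 T. ?c b = 0"
        using indep unfolding lin_indep_def by blast
      then have "f = (if 1 \<in> T then c 1 else 0)" by simp
      then show "f \<in> dickson_algebra (Suc m)" using T(3) zero_closed by (auto split: if_splits)
    qed
  qed
qed

text \<open>With Dickson's theorem available for \<open>m\<close>, spanning holds with
  \<open>D\<close> the full ring of \<open>GL (Suc m)\<close>-invariants, and the characters then
  give independence.\<close>

theorem parabolic_free_basis:
  "free_module_basis (invariants (Suc m) (GL (Suc m))) (invariants (Suc m) (parabolic m 1))
    (parabolic_basis m :: 'p::prime_card mpol set)"
proof -
  let ?D = "invariants (Suc m) (GL (Suc m)) :: 'p mpol set"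
  let ?M = "invariants (Suc m) (parabolic m 1) :: 'p mpol set"
  interpret dickson_coefficients ?D m
    by (rule dickson_coefficients.intro[OF subring_set_invariants], unfold_locales)
      (simp_all add: const_in_invariants dickson_in_invariants)
  interpret M: subring_set ?M by (rule subring_set_invariants)
  have sp: "?M \<subseteq> span"
    by (rule parabolic_invariants_subset_span) (simp add: dickson_theorem)
  have dM: "dickson m i \<in> ?M" if "i \<le> m" for i
    using dickson_in_invariants[OF that, where 'p = 'p] invariants_subset_parabolic by blast
  have B: "parabolic_basis m \<subseteq> ?M"
  proof -
    have "basis_elem m s e \<in> ?M" if "s \<le> m" for s e
      unfolding basis_elem_def
    proof (rule M.mult_closed)
      show "(if s = 0 then 1 else dickson m (s - 1) ^ CARD('p)) \<in> ?M"
        using M.one_closed M.power_closed[OF dM[of "s - 1"]] that by (cases "s = 0") (simp_all del: One_nat_def)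
      show "(\<Prod>i\<in>{s..<m}. dickson m i ^ e i) \<in> ?M"
        by (rule M.prod_closed, rule M.power_closed, rule dM) simp
    qed
    then show ?thesis unfolding parabolic_basis_def by blast
  qed
  have "span \<subseteq> ?M"
  proof
    fix f assume "f \<in> span"
    then obtain T c where T: "T \<subseteq> parabolic_basis m" "c ` T \<subseteq> ?D" "f = (\<Sum>b\<in>T. c b * b)"
      by (auto simp: lin_span_def)
    have "c b * b \<in> ?M" if "b \<in> T" for b
      using T(1,2) that B invariants_GL_subset_parabolic by (intro M.mult_closed) blast+
    then show "f \<in> ?M" unfolding T(3) by (rule M.sum_closed)
  qed
  then show ?thesis
    unfolding free_module_basis_def using B sp lin_indep_parabolic_basis[OF sp] by blast
qed

theorem theorem32:
  fixes p n :: nat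
  assumes "p = CARD('p::prime_card)" and "odd p" and "n \<ge> 2"
  shows "free_module_basis
     (invariants n (GL n) :: 'p mpol set)
     (invariants n (parabolic (n - 1) 1))
     ({\<Prod>i=0..n-2. dickson (n - 1) i ^ e i | e. \<forall>i\<in>{0..n-2}. e i \<le> p - 1} \<union>
      (\<Union>t\<in>{1..n-1}.
         {dickson (n - 1) (t - 1) ^ p * (\<Prod>i=t..n-2. dickson (n - 1) i ^ e i) | e.
            \<forall>i\<in>{t..n-2}. e i \<le> p - 1}))"
proof -
  define m where "m = n - 1"
  have n: "n = Suc m" "n - 1 = m" using assms(3) by (simp_all add: m_def)
  \<comment> \<open>Since \<open>n \<ge> 2\<close>, the subtraction \<open>n - 2\<close> is not
    truncated and equals \<open>m - 1\<close>; for \<open>t = n - 1\<close> the product is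
    empty.\<close>
  have ivl: "{t..n-2} = {t..<m}" for t using assms(3) by (auto simp: m_def)
  have le: "e \<le> p - 1 \<longleftrightarrow> e < CARD('p)" for e
    using CARD_prime_gt_1[where 'p = 'p] by (auto simp: assms(1))
  have "{\<Prod>i=0..n-2. dickson (n - 1) i ^ e i | e. \<forall>i\<in>{0..n-2}. e i \<le> p - 1} =
      {basis_elem m 0 e :: 'p mpol | e. \<forall>i\<in>{0..<m}. e i < CARD('p)}"
    unfolding ivl le n(2) by (simp add: basis_elem_def)
  moreover have "{dickson (n - 1) (t - 1) ^ p * (\<Prod>i=t..n-2. dickson (n - 1) i ^ e i) | e.
        \<forall>i\<in>{t..n-2}. e i \<le> p - 1} =
      {basis_elem m t e :: 'p mpol | e. \<forall>i\<in>{t..<m}. e i < CARD('p)}" if "t \<in> {1..n-1}" for t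
    unfolding ivl le n(2) using that by (simp add: basis_elem_def assms(1))
  moreover have "parabolic_basis m = {basis_elem m 0 e :: 'p mpol | e. \<forall>i\<in>{0..<m}. e i < CARD('p)} \<union>
      (\<Union>t\<in>{1..n-1}. {basis_elem m t e | e. \<forall>i\<in>{t..<m}. e i < CARD('p)})" (is "_ = ?A \<union> (\<Union>t\<in>_. ?C t)")
  proof -
    have "parabolic_basis m = (\<Union>t\<in>{..m}. ?C t)" by (auto simp: parabolic_basis_def)
    moreover have "{..m} = insert 0 {1..n-1}" unfolding n(2) by auto
    ultimately show ?thesis by simp
  qed
  ultimately show ?thesis
    using parabolic_free_basis[of m, where 'p = 'p] by (simp add: n cong: SUP_cong_simp)
qed

end
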